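(* Let $P$ be a poset. Then $P$ is sub-representable if and only if $P$ is (up to order-isomorphism) either: (i) a flower, or (ii) a co-flower, or (iii) the poset of a pinboard, or (iv) the poset of a co-pinboard.
   Context: For posets $P_1,P_2$, write $P_1\hookrightarrow P_2$ if $P_1$ is order-isomorphic to a subset of $P_2$ (with the induced order). Let $\mathbb P(P)$ denote the set of all subsets of $P$, each regarded as a poset with the induced order. A poset $P$ is sub-representable if there exists a map $g:\mathbb P(P)\to\mathbb P(P)$ such that for all $P_1,P_2\in\mathbb P(P)$: (i) $P_1\hookrightarrow P_2$ if and only if $g(P_1)\subseteq g(P_2)$; and (ii) $P_1\hookrightarrow g(P_1)\hookrightarrow P_1$. A linear order is well-ordered if every non-empty subset has a least element, and well-ordered* if every non-empty subset has a greatest element. For $x\in P$ put $U(x)=\{y\in P: y>x\}$ and $D(x)=\{y\in P: y<x\}$ (strict inequalities). $P$ is a flower if there exists $x\in P$ such that $D(x)$ is a well-ordered* chain, $U(x)$ is an antichain with $|U(x)|>1$, and $D(x)\cup U(x)\cup\{x\}=P$. $P$ is a co-flower if there exists $x\in P$ such that $U(x)$ is a well-ordered chain, $D(x)$ is an antichain with $|D(x)|>1$, and $D(x)\cup U(x)\cup\{x\}=P$. (The sets $D(x)$ in a flower and $U(x)$ in a co-flower may be empty.) A pinboard is a finite set of ordered pairs $\{(h_i,f_i):1\le i\le k\}$ in which, for each $i$, $h_i$ is an ordinal, $f_i$ is a cardinal, and $h_i,f_i$ are not both infinite. A co-pinboard is a finite set of ordered pairs $\{(h_i,f_i):1\le i\le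 k\}$ such that $\{(h_i^*,f_i):1\le i\le k\}$ is a pinboard, where $h_i^*$ denotes the order-dual of the linear order $h_i$ (so each $h_i$ is the dual of an ordinal). The poset of a pinboard or co-pinboard $\{(h_i,f_i):1\le i\le k\}$ is the disjoint union of $f_i$-many copies of the linear order $h_i$ for $1\le i\le k$, with elements of different copies incomparable. *)

theory Defs
  imports Main
begin

text \<open>
  A poset is a carrier \<open>A\<close> with a relation \<open>r\<close> such that \<^term>\<open>partial_order_on A r\<close>; the carrier
  may be empty. A subset \<open>X\<close> of the carrier carries the induced order, i.e. \<open>r\<close> read on \<open>X\<close> only.
\<close>

definition order_isomorphic :: "'a set \<Rightarrow> 'a rel \<Rightarrow> 'b set \<Rightarrow> 'b rel \<Rightarrow> bool" where
  "order_isomorphic A r B s \<longleftrightarrow>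
     (\<exists>f. bij_betw f A B \<and> (\<forall>x\<in>A. \<forall>y\<in>A. (x, y) \<in> r \<longleftrightarrow> (f x, f y) \<in> s))"

definition order_embeds :: "'a set \<Rightarrow> 'a rel \<Rightarrow> 'b set \<Rightarrow> 'b rel \<Rightarrow> bool" where
  "order_embeds A r B s \<longleftrightarrow> (\<exists>C\<subseteq>B. order_isomorphic A r C s)"

definition sub_representable :: "'a set \<Rightarrow> 'a rel \<Rightarrow> bool" where
  "sub_representable A r \<longleftrightarrow>
     (\<exists>g. (\<forall>X\<in>Pow A. g X \<in> Pow A) \<and>
          (\<forall>X\<in>Pow A. \<forall>Y\<in>Pow A. order_embeds X r Y r \<longleftrightarrow> g X \<subseteq> g Y) \<and>
          (\<forall>X\<in>Pow A. order_embeds X r (g X) r \<and> order_embeds (g X) r X r))"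

definition chain_on :: "'a set \<Rightarrow> 'a rel \<Rightarrow> bool" where
  "chain_on X r \<longleftrightarrow> (\<forall>x\<in>X. \<forall>y\<in>X. (x, y) \<in> r \<or> (y, x) \<in> r)"

definition well_ordered_chain_on :: "'a set \<Rightarrow> 'a rel \<Rightarrow> bool" where
  "well_ordered_chain_on X r \<longleftrightarrow>
     chain_on X r \<and> (\<forall>Y\<subseteq>X. Y \<noteq> {} \<longrightarrow> (\<exists>m\<in>Y. \<forall>y\<in>Y. (m, y) \<in> r))"

definition well_ordered_star_chain_on :: "'a set \<Rightarrow> 'a rel \<Rightarrow> bool" where
  "well_ordered_star_chain_on X r \<longleftrightarrow>
     chain_on X r \<and> (\<forall>Y\<subseteq>X. Y \<noteq> {} \<longrightarrow> (\<exists>m\<in>Y. \<forall>y\<in>Y. (y, m) \<in> r))"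

definition antichain_on :: "'a set \<Rightarrow> 'a rel \<Rightarrow> bool" where
  "antichain_on X r \<longleftrightarrow> (\<forall>x\<in>X. \<forall>y\<in>X. (x, y) \<in> r \<longrightarrow> x = y)"

text \<open>
  The strict up-set and down-set of \<open>x\<close> are \<^term>\<open>aboveS r x\<close> and \<^term>\<open>underS r x\<close>. That a set has
  more than one element is spelled out, because \<^const>\<open>card\<close> is \<open>0\<close> on infinite sets.
\<close>

definition flower :: "'a set \<Rightarrow> 'a rel \<Rightarrow> bool" where
  "flower A r \<longleftrightarrow>
     (\<exists>x\<in>A. well_ordered_star_chain_on (underS r x) r \<and>
            antichain_on (aboveS r x) r \<and>
            (\<exists>u\<in>aboveS r x. \<exists>v\<in>aboveS r x. u \<noteq> v) \<and>
            underS r x \<union> aboveS r x \<union> {x} = A)"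

definition co_flower :: "'a set \<Rightarrow> 'a rel \<Rightarrow> bool" where
  "co_flower A r \<longleftrightarrow>
     (\<exists>x\<in>A. well_ordered_chain_on (aboveS r x) r \<and>
            antichain_on (underS r x) r \<and>
            (\<exists>u\<in>underS r x. \<exists>v\<in>underS r x. u \<noteq> v) \<and>
            underS r x \<union> aboveS r x \<union> {x} = A)"

text \<open>
  Ordinals and cardinals are given by representatives: well-orders \<open>h\<close> and cardinal orders \<open>f\<close>,
  each on its own field, with \<^const>\<open>ordIso\<close> as equality. The last clause of \<open>pinboard\<close> makes
  different members of \<open>B\<close> represent different pairs (ordinal, cardinal), so that \<open>B\<close> really
  represents a set of such pairs.
\<close>

definition pinboard :: "('b rel \<times> 'c rel) set \<Rightarrow> bool" where
  "pinboard B \<longleftrightarrow>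
     finite B \<and>
     (\<forall>(h, f)\<in>B. Well_order h \<and> Card_order f \<and> \<not> (infinite (Field h) \<and> infinite (Field f))) \<and>
     (\<forall>(h, f)\<in>B. \<forall>(h', f')\<in>B. (h, h') \<in> ordIso \<and> (f, f') \<in> ordIso \<longrightarrow> h = h' \<and> f = f')"

definition co_pinboard :: "('b rel \<times> 'c rel) set \<Rightarrow> bool" where
  "co_pinboard B \<longleftrightarrow> pinboard ((\<lambda>(h, f). (h\<inverse>, f)) ` B)"

text \<open>
  The element \<open>((h, f), c, x)\<close> is the point \<open>x\<close> in copy number \<open>c\<close> of the linear order \<open>h\<close>, where the
  copies belonging to the pair \<open>(h, f)\<close> are indexed by the field of \<open>f\<close>.
\<close>

definition board_carrier :: "('b rel \<times> 'c rel) set \<Rightarrow> (('b rel \<times> 'c rel) \<times> 'c \<times> 'b) set" where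
  "board_carrier B = {((h, f), c, x) | h f c x. (h, f) \<in> B \<and> c \<in> Field f \<and> x \<in> Field h}"

definition board_order :: "('b rel \<times> 'c rel) set \<Rightarrow> (('b rel \<times> 'c rel) \<times> 'c \<times> 'b) rel" where
  "board_order B =
     {(((h, f), c, x), ((h, f), c, y)) | h f c x y. (h, f) \<in> B \<and> c \<in> Field f \<and> (x, y) \<in> h}"

text \<open>
  To be isomorphic to the poset of some (co-)pinboard. The existential over \<open>B\<close> can range over
  representatives on the element type of the poset without loss of generality: pairs with an empty
  \<open>h\<close> or \<open>f\<close> contribute no elements, and for any other pair both a copy of \<open>h\<close> and a set of
  cardinality \<open>f\<close> (one point from each copy) occur inside the poset.
\<close>

definition pinboard_poset :: "'a set \<Rightarrow> 'a rel \<Rightarrow> bool" where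
  "pinboard_poset A r \<longleftrightarrow>
     (\<exists>B :: ('a rel \<times> 'a rel) set. pinboard B \<and>
        order_isomorphic A r (board_carrier B) (board_order B))"

definition co_pinboard_poset :: "'a set \<Rightarrow> 'a rel \<Rightarrow> bool" where
  "co_pinboard_poset A r \<longleftrightarrow>
     (\<exists>B :: ('a rel \<times> 'a rel) set. co_pinboard B \<and>
        order_isomorphic A r (board_carrier B) (board_order B))"

end

theory Submission
  imports Defs
begin

text \<open>
  Necessity. For finite \<open>X\<close> the set \<open>g X\<close> is a copy of \<open>X\<close>, so two three-element subsets that contain
  both a comparable and an incomparable pair have the same image, the union of the images of a
  two-chain and a two-antichain; hence they are isomorphic. So if three points
  \<open>x < y, z\<close> with \<open>y\<close>, \<open>z\<close> incomparable occur, then every such triple has this shape, and the poset is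
  a chain below an antichain. If neither this triple nor its dual occurs, comparability is
  transitive and the poset is a disjoint union of chains. For the infinite part, the images of the
  finite chains increase to an infinite chain that is contained in \<open>g X\<close> whenever \<open>X\<close> has chains of all
  finite sizes. Therefore \<open>\<omega>\<close>, its dual, and disjoint unions of finite chains of unbounded size
  exclude each other, and the last kind excludes itself. In a chain below an antichain, the
  images of the finite chains lie below the image \<open>p\<close> of a point, so \<open>\<omega>\<close> cannot embed.

  Sufficiency. It is enough to select in each class of mutually embeddable subsets one set such
  that embeddability between selected sets implies inclusion. In a well-order the initial segments
  do this. In a disjoint union of well-orders, listed by decreasing length, one takes Young diagrams:
  row \<open>\<xi>\<close> has as many elements as there are components longer than \<open>\<xi>\<close>.
\<close>

unbundle cardinal_syntax

section \<open>Embeddings\<close>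

text \<open>Only the forward half of (i) has content, since (ii) turns an inclusion of images into
  an embedding. Mutual embeddings of finite sets are bijective, which is why the necessity proof can
  count elements of images. The obstacle to sufficiency is that a Young diagram keeps only the
  cardinality of each row, and equal rows need not mean mutual embeddability: one component of each
  length 1, 2, 3, ... has the same rows as countably many components of length omega. The pinboard
  condition excludes this. Infinite components are finite in number and the finite ones are bounded,
  so finitely many lengths occur, and a matching recovers the columns from the rows. In a co-flower
  the difficulty is another one: a single point below an infinite well-ordered chain is absorbed by
  the chain, while two incomparable points never are. So chains need canonical sets of their
  own.\<close>

lemma order_embedsI:
  assumes "inj_on f X" "\<And>x. x \<in> X \<Longrightarrow> f x \<in> Y"
    "\<And>x y. x \<in> X \<Longrightarrow> y \<in> X \<Longrightarrow> (x, y) \<in> r \<longleftrightarrow> (f x, f y) \<in> s"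
  shows "order_embeds X r Y s"
  unfolding order_embeds_def order_isomorphic_def
  using assms by (intro exI[of _ "f ` X"]) (auto simp: bij_betw_def)

lemma order_embedsE:
  assumes "order_embeds X r Y s"
  obtains f where "inj_on f X" "\<And>x. x \<in> X \<Longrightarrow> f x \<in> Y"
    "\<And>x y. x \<in> X \<Longrightarrow> y \<in> X \<Longrightarrow> (x, y) \<in> r \<longleftrightarrow> (f x, f y) \<in> s"
proof -
  obtain C f where *: "C \<subseteq> Y" "bij_betw f X C"
    "\<forall>x\<in>X. \<forall>y\<in>X. (x, y) \<in> r \<longleftrightarrow> (f x, f y) \<in> s"
    using assms unfolding order_embeds_def order_isomorphic_def by auto
  show ?thesis by (rule that[of f]) (use * in \<open>auto simp: bij_betw_def\<close>)
qed

lemma order_embeds_subset: "X \<subseteq> Y \<Longrightarrow> order_embeds X r Y r"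
  by (rule order_embedsI[of id]) auto

lemma order_embeds_trans [trans]:
  assumes "order_embeds X r Y s" "order_embeds Y s Z t"
  shows "order_embeds X r Z t"
proof -
  obtain f where f: "inj_on f X" "\<And>x. x \<in> X \<Longrightarrow> f x \<in> Y"
    "\<And>x y. x \<in> X \<Longrightarrow> y \<in> X \<Longrightarrow> (x, y) \<in> r \<longleftrightarrow> (f x, f y) \<in> s"
    using assms(1) by (rule order_embedsE) blast
  obtain g where g: "inj_on g Y" "\<And>x. x \<in> Y \<Longrightarrow> g x \<in> Z"
    "\<And>x y. x \<in> Y \<Longrightarrow> y \<in> Y \<Longrightarrow> (x, y) \<in> s \<longleftrightarrow> (g x, g y) \<in> t"
    using assms(2) by (rule order_embedsE) blast
  show ?thesis
    by (rule order_embedsI[of "g \<circ> f"]) (use f g in \<open>auto simp: inj_on_def\<close>)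
qed

lemma order_embeds_image:
  assumes "inj_on f X" "\<And>x y. x \<in> X \<Longrightarrow> y \<in> X \<Longrightarrow> (x, y) \<in> r \<longleftrightarrow> (f x, f y) \<in> s"
  shows "order_embeds X r (f ` X) s" "order_embeds (f ` X) s X r"
proof -
  show "order_embeds X r (f ` X) s"
    by (rule order_embedsI[of f]) (use assms in auto)
  show "order_embeds (f ` X) s X r"
    by (rule order_embedsI[of "inv_into X f"])
      (use assms in \<open>auto intro: inj_on_inv_into\<close>)
qed

lemma order_embeds_converse: "order_embeds X (r\<inverse>) Y (s\<inverse>) \<longleftrightarrow> order_embeds X r Y s"
  unfolding order_embeds_def order_isomorphic_def by (simp add: all_conj_distrib) blast

lemma order_embeds_empty: "order_embeds X r {} s \<longleftrightarrow> X = {}"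
  unfolding order_embeds_def order_isomorphic_def by (auto simp: bij_betw_def)

lemma order_embeds_finite:
  assumes "order_embeds X r Y s" "finite Y"
  shows "finite X" "card X \<le> card Y"
proof -
  obtain f where f: "inj_on f X" "\<And>x. x \<in> X \<Longrightarrow> f x \<in> Y"
    using assms(1) by (rule order_embedsE) blast
  then have "f ` X \<subseteq> Y" by blast
  with f assms(2) show "finite X" "card X \<le> card Y"
    by (auto intro: inj_on_finite card_inj_on_le)
qed

lemma sub_representable_converse: "sub_representable A (r\<inverse>) \<longleftrightarrow> sub_representable A r"
  unfolding sub_representable_def order_embeds_converse ..

text \<open>The missing direction comes from composing: \<open>X\<close> embeds in
  \<open>g X\<close>, which is contained in \<open>g Y\<close>, which embeds in
  \<open>Y\<close>.\<close>

lemma sub_representableI: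
  assumes "\<And>X. X \<subseteq> A \<Longrightarrow> g X \<subseteq> A"
    and "\<And>X. X \<subseteq> A \<Longrightarrow> order_embeds X r (g X) r"
    and "\<And>X. X \<subseteq> A \<Longrightarrow> order_embeds (g X) r X r"
    and "\<And>X Y. X \<subseteq> A \<Longrightarrow> Y \<subseteq> A \<Longrightarrow> order_embeds X r Y r \<Longrightarrow> g X \<subseteq> g Y"
  shows "sub_representable A r"
  unfolding sub_representable_def
proof (intro exI[of _ g] conjI ballI iffI)
  fix X Y assume *: "X \<in> Pow A" "Y \<in> Pow A" "g X \<subseteq> g Y"
  have "order_embeds X r (g X) r" using assms(2) * by blast
  also have "order_embeds (g X) r (g Y) r" using * by (intro order_embeds_subset)
  also have "order_embeds (g Y) r Y r" using assms(3) * by blast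
  finally show "order_embeds X r Y r" .
qed (use assms in auto)

text \<open>The sets in the family may be chosen independently for each \<open>X\<close>: for
  mutually embeddable sets, \<open>mono\<close> makes the two choices include each other, so they
  agree.\<close>

lemma sub_representable_canonicalI:
  assumes "\<And>X. X \<subseteq> A \<Longrightarrow> \<exists>C\<in>\<C>. C \<subseteq> A \<and> order_embeds X r C r \<and> order_embeds C r X r"
    and mono: "\<And>C D. C \<in> \<C> \<Longrightarrow> D \<in> \<C> \<Longrightarrow> order_embeds C r D r \<Longrightarrow> C \<subseteq> D"
  shows "sub_representable A r"
proof -
  from assms(1) obtain g where g: "\<And>X. X \<subseteq> A \<Longrightarrow>
      g X \<in> \<C> \<and> g X \<subseteq> A \<and> order_embeds X r (g X) r \<and> order_embeds (g X) r X r"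
    by metis
  show ?thesis
  proof (rule sub_representableI[of _ g])
    fix X Y assume "X \<subseteq> A" "Y \<subseteq> A" "order_embeds X r Y r"
    then show "g X \<subseteq> g Y" using g mono order_embeds_trans by metis
  qed (use g in auto)
qed

lemma sub_representableE:
  assumes "sub_representable A r"
  obtains g where "\<And>X. X \<subseteq> A \<Longrightarrow> g X \<subseteq> A"
    "\<And>X Y. X \<subseteq> A \<Longrightarrow> Y \<subseteq> A \<Longrightarrow> order_embeds X r Y r \<longleftrightarrow> g X \<subseteq> g Y"
    "\<And>X. X \<subseteq> A \<Longrightarrow> order_embeds X r (g X) r"
    "\<And>X. X \<subseteq> A \<Longrightarrow> order_embeds (g X) r X r"
proof -
  obtain g where g: "\<forall>X\<in>Pow A. g X \<in> Pow A"
      "\<forall>X\<in>Pow A. \<forall>Y\<in>Pow A. order_embeds X r Y r \<longleftrightarrow> g X \<subseteq> g Y"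
      "\<forall>X\<in>Pow A. order_embeds X r (g X) r \<and> order_embeds (g X) r X r"
    using assms unfolding sub_representable_def by (elim exE conjE)
  show ?thesis
    by (rule that[of g]; (simp add: g(3); fail)?) (use g(1,2) in auto)
qed

lemma order_isomorphicE:
  assumes "order_isomorphic A r B s"
  obtains f where "bij_betw f A B"
    "\<And>x y. x \<in> A \<Longrightarrow> y \<in> A \<Longrightarrow> (x, y) \<in> r \<longleftrightarrow> (f x, f y) \<in> s"
  using assms unfolding order_isomorphic_def by (elim exE conjE) simp

lemma sub_representable_iso:
  assumes iso: "order_isomorphic A r B s" and sub: "sub_representable B s"
  shows "sub_representable A r"
proof -
  obtain f where f: "bij_betw f A B"
    "\<And>x y. x \<in> A \<Longrightarrow> y \<in> A \<Longrightarrow> (x, y) \<in> r \<longleftrightarrow> (f x, f y) \<in> s"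
    using iso by (rule order_isomorphicE) blast
  obtain g where gP: "\<And>X. X \<subseteq> B \<Longrightarrow> g X \<subseteq> B"
    and gm: "\<And>X Y. X \<subseteq> B \<Longrightarrow> Y \<subseteq> B \<Longrightarrow> order_embeds X s Y s \<longleftrightarrow> g X \<subseteq> g Y"
    and ge: "\<And>X. X \<subseteq> B \<Longrightarrow> order_embeds X s (g X) s" "\<And>X. X \<subseteq> B \<Longrightarrow> order_embeds (g X) s X s"
    using sub by (rule sub_representableE) blast
  have to: "order_embeds X r (f ` X) s" "order_embeds (f ` X) s X r" if "X \<subseteq> A" for X
    using order_embeds_image[of f X r s] f that by (auto simp: bij_betw_def inj_on_def subset_iff)
  have fB: "f ` X \<subseteq> B" if "X \<subseteq> A" for X
    using f that by (auto simp: bij_betw_def)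
  define k where "k X = {x \<in> A. f x \<in> g (f ` X)}" for X
  have kA: "k X \<subseteq> A" for X by (auto simp: k_def)
  have fk: "f ` k X = g (f ` X)" if "X \<subseteq> A" for X
    using gP[OF fB[OF that]] f(1) unfolding k_def bij_betw_def by auto
  show ?thesis
  proof (rule sub_representableI[of _ k])
    fix X assume X: "X \<subseteq> A"
    show "k X \<subseteq> A" by (rule kA)
    have "order_embeds X r (f ` X) s" by (rule to) fact
    also have "order_embeds (f ` X) s (f ` k X) s" using ge[OF fB[OF X]] fk[OF X] by simp
    also have "order_embeds (f ` k X) s (k X) r" by (rule to) (rule kA)
    finally show "order_embeds X r (k X) r" .
    have "order_embeds (k X) r (f ` k X) s" by (rule to) (rule kA)
    also have "order_embeds (f ` k X) s (f ` X) s" using ge[OF fB[OF X]] fk[OF X] by simp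
    also have "order_embeds (f ` X) s X r" by (rule to) fact
    finally show "order_embeds (k X) r X r" .
  next
    fix X Y assume XY: "X \<subseteq> A" "Y \<subseteq> A" "order_embeds X r Y r"
    have "order_embeds (f ` X) s (f ` Y) s"
      using to XY order_embeds_trans by metis
    then show "k X \<subseteq> k Y" using gm[OF fB fB] XY unfolding k_def by blast
  qed
qed

section \<open>Initial segments of well-orders\<close>

lemma Well_order_total:
  "Well_order w \<Longrightarrow> x \<in> Field w \<Longrightarrow> y \<in> Field w \<Longrightarrow> (x, y) \<in> w \<or> (y, x) \<in> w"
  unfolding well_order_on_def linear_order_on_def total_on_def
    partial_order_on_def preorder_on_def refl_on_def by metis

lemma Well_order_antisym: "Well_order w \<Longrightarrow> (x, y) \<in> w \<Longrightarrow> (y, x) \<in> w \<Longrightarrow> x = y"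
  unfolding well_order_on_def linear_order_on_def partial_order_on_def by (blast dest: antisymD)

lemma ofilterD: "ofilter w E \<Longrightarrow> x \<in> E \<Longrightarrow> (y, x) \<in> w \<Longrightarrow> y \<in> E"
  unfolding ofilter_def under_def by blast

text \<open>By well-founded induction an embedding \<open>f\<close> satisfies
  \<open>(x, f x) \<in> w\<close>: if \<open>f x\<close> were strictly below \<open>x\<close>, then
  \<open>f (f x)\<close> would be strictly below \<open>f x\<close>, against the induction
  hypothesis at \<open>f x\<close>. As \<open>E'\<close> is closed downwards, it contains
  \<open>x\<close>.\<close>

lemma ofilter_embeds_imp_subset:
  assumes w: "Well_order w" and E: "ofilter w E" and E': "ofilter w E'"
    and emb: "order_embeds E w E' w"
  shows "E \<subseteq> E'"
proof
  obtain f where f: "inj_on f E" "\<And>x. x \<in> E \<Longrightarrow> f x \<in> E'"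
    "\<And>x y. x \<in> E \<Longrightarrow> y \<in> E \<Longrightarrow> (x, y) \<in> w \<longleftrightarrow> (f x, f y) \<in> w"
    using emb by (rule order_embedsE) blast
  have EF: "E \<subseteq> Field w" "E' \<subseteq> Field w" using E E' by (auto simp: ofilter_def)
  note tot = Well_order_total[OF w] and anti = Well_order_antisym[OF w]
  have wf: "wf (w - Id)" using w by (simp add: well_order_on_def)
  fix x assume "x \<in> E"
  have "x \<in> E \<longrightarrow> (x, f x) \<in> w"
  proof (induction x rule: wf_induct_rule[OF wf])
    case (1 x)
    show ?case
    proof (rule impI, rule ccontr)
      assume x: "x \<in> E" and n: "(x, f x) \<notin> w"
      have fx: "(f x, x) \<in> w" using tot n x f(2) EF by blast
      then have fxE: "f x \<in> E" using x E by (auto simp: ofilter_def under_def)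
      have ne: "f x \<noteq> x" using n tot x EF by fastforce
      have "(f x, f (f x)) \<in> w" using 1 fx ne fxE by blast
      moreover have "(f (f x), f x) \<in> w" using f(3)[OF fxE x] fx by blast
      ultimately show False using anti ne f(1) fxE x by (metis inj_onD)
    qed
  qed
  with \<open>x \<in> E\<close> f(2) E' show "x \<in> E'" by (auto simp: ofilter_def under_def)
qed

lemma ordLeq_ofilter_iso:
  assumes "p \<le>o w"
  obtains f where "inj_on f (Field p)" "ofilter w (f ` Field p)"
    "\<And>x y. x \<in> Field p \<Longrightarrow> y \<in> Field p \<Longrightarrow> (x, y) \<in> p \<longleftrightarrow> (f x, f y) \<in> w"
proof -
  obtain f where wp: "Well_order p" "Well_order w" and f: "embed p w f"
    using assms unfolding ordLeq_def by blast
  have inj: "inj_on f (Field p)" by (rule embed_inj_on[OF wp(1) f])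
  have of: "ofilter w (f ` Field p)" by (rule embed_Field_ofilter[OF wp f])
  have mono: "(f x, f y) \<in> w" if "(x, y) \<in> p" for x y
    using embed_compat[OF f] that by (simp add: compat_def)
  have "(x, y) \<in> p" if "x \<in> Field p" "y \<in> Field p" "(f x, f y) \<in> w" for x y
  proof (rule ccontr)
    assume n: "(x, y) \<notin> p"
    then have "(y, x) \<in> p" "x \<noteq> y" using Well_order_total[OF wp(1)] that by blast+
    then have "f x = f y" using mono that Well_order_antisym[OF wp(2)] by blast
    then show False using inj that \<open>x \<noteq> y\<close> by (auto dest: inj_onD)
  qed
  with that inj of mono show ?thesis by blast
qed

text \<open>Well-orders are comparable. Either \<open>X\<close> is isomorphic to a segment of
  \<open>w\<close>, or all of \<open>w\<close> embeds in \<open>X\<close>, and then the whole field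
  serves as the segment.\<close>

lemma subset_equimorphic_ofilter:
  assumes w: "Well_order w" and X: "X \<subseteq> Field w"
  shows "\<exists>E. ofilter w E \<and> order_embeds X w E w \<and> order_embeds E w X w"
proof -
  let ?p = "Restr w X"
  have p: "Well_order ?p" using w by (rule Well_order_Restr)
  have F: "Field ?p = X" using well_order_on_Restr[OF w X] by (metis well_order_on_Well_order)
  from ordLeq_total[OF p w] show ?thesis
  proof
    assume "?p \<le>o w"
    then obtain f where f: "inj_on f X" "ofilter w (f ` X)"
      "\<And>x y. x \<in> X \<Longrightarrow> y \<in> X \<Longrightarrow> (x, y) \<in> ?p \<longleftrightarrow> (f x, f y) \<in> w"
      using ordLeq_ofilter_iso F by metis
    with order_embeds_image[of f X w w] show ?thesis by auto
  next
    assume "w \<le>o ?p"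
    then obtain f where f: "inj_on f (Field w)" "ofilter ?p (f ` Field w)"
      "\<And>x y. x \<in> Field w \<Longrightarrow> y \<in> Field w \<Longrightarrow> (x, y) \<in> w \<longleftrightarrow> (f x, f y) \<in> ?p"
      using ordLeq_ofilter_iso by metis
    have sub: "f ` Field w \<subseteq> X" using f(2) F by (auto simp: ofilter_def)
    have "order_embeds (Field w) w X w"
      by (rule order_embedsI[OF f(1)]) (use sub f(3) in auto)
    moreover have "ofilter w (Field w)" by (auto simp: ofilter_def under_def Field_def)
    ultimately show ?thesis using order_embeds_subset[OF X] by blast
  qed
qed

text \<open>
  The least initial segment of \<open>s\<close> with at least as many elements as \<open>M\<close>. If there is none, this is
  the intersection of the empty family, i.e. \<^term>\<open>UNIV\<close>.
\<close>

definition cardinal_segment :: "'a rel \<Rightarrow> 'b set \<Rightarrow> 'a set" where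
  "cardinal_segment s M = \<Inter>{I. ofilter s I \<and> |M| \<le>o |I|}"

lemma cardinal_segment_subset:
  "ofilter s I \<Longrightarrow> |M| \<le>o |I| \<Longrightarrow> cardinal_segment s M \<subseteq> I"
  by (auto simp: cardinal_segment_def)

lemma cardinal_segment_mono:
  "|M| \<le>o |N| \<Longrightarrow> cardinal_segment s M \<subseteq> cardinal_segment s N"
  unfolding cardinal_segment_def by (auto intro: ordLeq_transitive)

text \<open>Otherwise every member of \<open>S\<close> meets \<open>T\<close>. A member that omits
  the least point \<open>a\<close> of \<open>T\<close> contains some \<open>b\<close> of
  \<open>T\<close>, which lies above \<open>a\<close>, so downward closure puts \<open>a\<close>
  into that member.\<close>

lemma ofilter_Inter_attained:
  assumes w: "Well_order w" and S: "\<And>I. I \<in> S \<Longrightarrow> ofilter w I" and ne: "S \<noteq> {}"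
  shows "\<Inter>S \<in> S"
proof (rule ccontr)
  assume n: "\<Inter>S \<notin> S"
  define T where "T = \<Union>S - \<Inter>S"
  have ex: "\<exists>a\<in>I. a \<in> T" if "I \<in> S" for I
  proof (rule ccontr)
    assume "\<not> ?thesis"
    with that have "I = \<Inter>S" by (auto simp: T_def)
    with n that show False by simp
  qed
  from ne ex obtain a0 where "a0 \<in> T" by blast
  moreover have wf: "wf (w - Id)" using w by (simp add: well_order_on_def)
  ultimately obtain a where a: "a \<in> T" "\<And>y. (y, a) \<in> w - Id \<Longrightarrow> y \<notin> T"
    unfolding wf_eq_minimal by blast
  then obtain I where I: "I \<in> S" "a \<notin> I" by (auto simp: T_def)
  obtain b where b: "b \<in> I" "b \<in> T" using ex I by blast
  have "b \<in> Field w" using b S I by (auto simp: ofilter_def)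
  moreover have "a \<in> Field w" using a S by (auto simp: T_def ofilter_def)
  ultimately have "(a, b) \<in> w \<or> (b, a) \<in> w - Id"
    using Well_order_total[OF w] b I by blast
  moreover have "(a, b) \<notin> w" using ofilterD[OF S[OF I(1)] b(1)] I(2) by blast
  ultimately show False using a(2) b(2) by blast
qed

text \<open>Comparing \<open>|M|\<close> with \<open>s\<close> yields a segment equinumerous with
  \<open>M\<close>. So the intersected family is non-empty, attains its intersection, and its least
  member is no larger than \<open>M\<close>.\<close>

lemma cardinal_segment:
  assumes s: "Well_order s" and M: "M \<subseteq> Field s"
  shows "ofilter s (cardinal_segment s M)" "|cardinal_segment s M| =o |M|"
proof -
  let ?S = "{I. ofilter s I \<and> |M| \<le>o |I|}"
  have "|M| \<le>o |Field s|" using M by (rule card_of_mono1)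
  also have "|Field s| \<le>o s" using s by (rule card_of_least)
  finally obtain f where f: "inj_on f M" "ofilter s (f ` M)"
    by (rule ordLeq_ofilter_iso) (simp add: Field_card_of)
  have fM: "|M| =o |f ` M|" using f(1) card_of_ordIsoI by (metis bij_betw_imageI)
  have "cardinal_segment s M \<in> ?S"
    unfolding cardinal_segment_def
    by (rule ofilter_Inter_attained[OF s]) (use f fM ordIso_imp_ordLeq in blast)+
  then show "ofilter s (cardinal_segment s M)" "|cardinal_segment s M| =o |M|"
    using ordLeq_ordIso_trans[OF card_of_mono1[OF cardinal_segment_subset[OF f(2)
          ordIso_imp_ordLeq[OF fM]]] ordIso_symmetric[OF fM]]
    by (simp_all add: ordIso_iff_ordLeq)
qed

section \<open>Matchings with nested neighbourhoods\<close>

lemma card_of_ordLeqE: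
  assumes "|A| \<le>o |B|"
  obtains f where "inj_on f A \<and> f ` A \<subseteq> B"
  using assms unfolding card_of_ordLeq[symmetric] ..

text \<open>Cardinal subtraction is safe in two cases: for finite \<open>C\<close> by counting, and
  for infinite \<open>C\<close> because removing a strictly smaller set from \<open>D\<close> leaves
  at least \<open>|C|\<close> elements.\<close>

lemma card_of_Diff_image:
  assumes CD: "|C| \<le>o |D|" and C': "C' \<subseteq> C" and inj: "inj_on f C'" "f ` C' \<subseteq> D"
    and small: "finite C \<or> |C'| <o |C|"
  shows "|C - C'| \<le>o |D - f ` C'|"
proof (cases "finite C")
  case True
  obtain h where h: "inj_on h C \<and> h ` C \<subseteq> D"
    using CD by (rule card_of_ordLeqE)
  \<comment> \<open>\<open>D\<close> may be infinite, so the count takes place in a finite part of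
    it that contains both images.\<close>
  define D' where "D' = h ` C \<union> f ` C'"
  have fin: "finite D'" "finite C'" using True C' by (auto simp: D'_def intro: finite_subset)
  have "card C \<le> card D'"
    using h fin by (intro card_inj_on_le[of h]) (auto simp: D'_def)
  then have "card (C - C') \<le> card (D' - f ` C')"
    using C' fin inj by (simp add: card_Diff_subset card_image D'_def)
  then have "|C - C'| \<le>o |D' - f ` C'|"
    using True fin by (simp add: card_of_ordLeq[symmetric] inj_on_iff_card_le)
  also have "|D' - f ` C'| \<le>o |D - f ` C'|"
    using h inj by (intro card_of_mono1) (auto simp: D'_def)
  finally show ?thesis .
next
  case False
  have "|f ` C'| \<le>o |C'|" by (rule card_of_image)
  also have "|C'| <o |C|" using small False by simp
  finally have lt: "|f ` C'| <o |C|" .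
  have "|C| \<le>o |D - f ` C'|"
  proof (rule ccontr)
    assume "\<not> ?thesis"
    then have "|D - f ` C'| <o |C|"
      by (simp add: not_ordLeq_iff_ordLess[OF card_of_Well_order card_of_Well_order])
    then have "|(D - f ` C') \<union> f ` C'| <o |C|"
      using lt False by (intro card_of_Un_ordLess_infinite)
    moreover have "(D - f ` C') \<union> f ` C' = D" using inj by blast
    ultimately show False using CD not_ordLess_ordLeq by metis
  qed
  then show ?thesis using card_of_mono1[of "C - C'" C] ordLeq_transitive by blast
qed

lemma finite_chain_Inter_Union:
  assumes "finite S" "S \<noteq> {}" "\<And>s t. s \<in> S \<Longrightarrow> t \<in> S \<Longrightarrow> s \<subseteq> t \<or> t \<subseteq> s"
  shows "\<Inter>S \<in> S \<and> \<Union>S \<in> S"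
  using assms
proof (induction rule: finite_ne_induct)
  case (insert t F)
  then have "\<Inter>F \<in> F" "\<Union>F \<in> F" by simp_all
  moreover from this have "\<Inter>F \<subseteq> t \<or> t \<subseteq> \<Inter>F" "\<Union>F \<subseteq> t \<or> t \<subseteq> \<Union>F"
    using insert.prems by simp_all
  ultimately show ?case by (auto simp: Int_absorb1 Int_absorb2 Un_absorb1 Un_absorb2)
qed simp

text \<open>
  A Hall-type matching for nested neighbourhoods, by induction on the number of values of \<open>l\<close>. The
  elements with the smallest value are matched last; if there might be no room for them because the
  others are just as many, they are treated as if they had the second smallest value.
\<close>

lemma threshold_matching:
  fixes l :: "'c \<Rightarrow> 'e set" and m :: "'d \<Rightarrow> 'e set"
  assumes "finite (l ` C)"
    and "\<And>c c'. c \<in> C \<Longrightarrow> c' \<in> C \<Longrightarrow> l c \<subseteq> l c' \<or> l c' \<subseteq> l c"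
    and "\<And>c. c \<in> C \<Longrightarrow> |{c' \<in> C. l c \<subseteq> l c'}| \<le>o |{d \<in> D. l c \<subseteq> m d}|"
  shows "\<exists>\<phi>. inj_on \<phi> C \<and> (\<forall>c\<in>C. \<phi> c \<in> D \<and> l c \<subseteq> m (\<phi> c))"
  using assms
proof (induction "card (l ` C)" arbitrary: l C)
  case 0
  then have "C = {}" by auto
  then show ?case by simp
next
  case (Suc n)
  note fin = Suc.prems(1) and chain = Suc.prems(2) and le = Suc.prems(3)
  have ne: "l ` C \<noteq> {}" using Suc.hyps(2) by auto
  have chain': "s \<subseteq> t \<or> t \<subseteq> s" if st: "s \<in> l ` C" "t \<in> l ` C" for s t
  proof -
    from st obtain c c' where "c \<in> C" "c' \<in> C" "s = l c" "t = l c'" by (elim imageE)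
    then show ?thesis using chain by simp
  qed
  have "\<Inter>(l ` C) \<in> l ` C"
    using finite_chain_Inter_Union[OF fin ne chain'] by simp
  then obtain c0 where c0: "c0 \<in> C" "\<And>c. c \<in> C \<Longrightarrow> l c0 \<subseteq> l c" by force
  define C' where "C' = {c \<in> C. l c \<noteq> l c0}"
  define D' where "D' = {d \<in> D. l c0 \<subseteq> m d}"
  have CD: "|C| \<le>o |D'|"
  proof -
    have "{c \<in> C. l c0 \<subseteq> l c} = C" using c0 by blast
    with le[OF c0(1)] show ?thesis by (simp add: D'_def)
  qed
  have lC': "l ` C' = l ` C - {l c0}" by (auto simp: C'_def)
  have cardC': "card (l ` C') = n" using Suc.hyps(2) fin c0 by (simp add: lC')
  show ?case
  proof (cases "finite C \<or> |C'| <o |C|")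
    case True
    have "\<exists>\<phi>. inj_on \<phi> C' \<and> (\<forall>c\<in>C'. \<phi> c \<in> D \<and> l c \<subseteq> m (\<phi> c))"
    proof (rule Suc.hyps(1))
      show "n = card (l ` C')" using cardC' by simp
      show "finite (l ` C')" using fin lC' by simp
      show "l c \<subseteq> l c' \<or> l c' \<subseteq> l c" if "c \<in> C'" "c' \<in> C'" for c c'
        using chain that by (auto simp: C'_def)
      show "|{c' \<in> C'. l c \<subseteq> l c'}| \<le>o |{d \<in> D. l c \<subseteq> m d}|" if "c \<in> C'" for c
      proof -
        have "|{c' \<in> C'. l c \<subseteq> l c'}| \<le>o |{c' \<in> C. l c \<subseteq> l c'}|"
          by (rule card_of_mono1) (auto simp: C'_def)
        also have "|{c' \<in> C. l c \<subseteq> l c'}| \<le>o |{d \<in> D. l c \<subseteq> m d}|"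
          using le that by (simp add: C'_def)
        finally show ?thesis .
      qed
    qed
    then obtain \<phi> where \<phi>: "inj_on \<phi> C'" "\<And>c. c \<in> C' \<Longrightarrow> \<phi> c \<in> D \<and> l c \<subseteq> m (\<phi> c)"
      by blast
    have sub: "\<phi> ` C' \<subseteq> D'"
      using \<phi> c0 unfolding D'_def C'_def by fastforce
    have "|C - C'| \<le>o |D' - \<phi> ` C'|"
      by (rule card_of_Diff_image[OF CD _ \<phi>(1) sub True]) (auto simp: C'_def)
    then obtain \<psi> where \<psi>: "inj_on \<psi> (C - C') \<and> \<psi> ` (C - C') \<subseteq> D' - \<phi> ` C'"
      by (rule card_of_ordLeqE)
    define \<theta> where "\<theta> c = (if c \<in> C' then \<phi> c else \<psi> c)" for c
    have "inj_on \<theta> C"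
      unfolding inj_on_def
    proof (intro ballI impI)
      fix x y assume xy: "x \<in> C" "y \<in> C" "\<theta> x = \<theta> y"
      have *: "\<psi> u \<noteq> \<phi> v" if "u \<in> C - C'" "v \<in> C'" for u v
        using \<psi> that by blast
      show "x = y"
        using xy *[of x y] *[of y x] inj_onD[OF \<phi>(1), of x y] inj_onD[OF conjunct1[OF \<psi>], of x y]
        by (auto simp: \<theta>_def split: if_splits)
    qed
    moreover have "\<theta> c \<in> D \<and> l c \<subseteq> m (\<theta> c)" if "c \<in> C" for c
    proof (cases "c \<in> C'")
      case False
      then have "l c = l c0" "\<psi> c \<in> D'" using that \<psi> by (auto simp: C'_def)
      then show ?thesis using False by (simp add: \<theta>_def D'_def)
    qed (use \<phi> in \<open>simp add: \<theta>_def\<close>)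
    ultimately show ?thesis by blast
  next
    case False
    then have CC': "|C| \<le>o |C'|" and inf: "infinite C"
      by (simp_all add: not_ordLess_iff_ordLeq[OF card_of_Well_order card_of_Well_order])
    then have "C' \<noteq> {}" using card_of_ordLeq_infinite by blast
    then have ne': "l ` C' \<noteq> {}" by blast
    have fin': "finite (l ` C')" using fin lC' by simp
    have "\<Inter>(l ` C') \<in> l ` C'"
      by (rule conjunct1[OF finite_chain_Inter_Union[OF fin' ne']]) (rule chain'; simp add: lC')
    then obtain c1 where c1: "c1 \<in> C'" "\<And>c. c \<in> C' \<Longrightarrow> l c1 \<subseteq> l c" by force
    define l' where "l' c = (if l c = l c0 then l c1 else l c)" for c
    have l'_ge: "l c \<subseteq> l' c" if "c \<in> C" for c
      using c0(2)[of c1] c1 by (auto simp: l'_def C'_def)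
    have l'_min: "l c1 \<subseteq> l' c" if "c \<in> C" for c
      using that c1(2) by (auto simp: l'_def C'_def)
    have l'C: "l' ` C = l ` C'"
      using c1 by (auto simp: l'_def C'_def)
    have "\<exists>\<phi>. inj_on \<phi> C \<and> (\<forall>c\<in>C. \<phi> c \<in> D \<and> l' c \<subseteq> m (\<phi> c))"
    proof (rule Suc.hyps(1))
      show "n = card (l' ` C)" using cardC' l'C by simp
      show "finite (l' ` C)" using fin lC' l'C by simp
      show "l' c \<subseteq> l' c' \<or> l' c' \<subseteq> l' c" if "c \<in> C" "c' \<in> C" for c c'
        using chain that c1 by (auto simp: C'_def l'_def)
      show "|{c' \<in> C. l' c \<subseteq> l' c'}| \<le>o |{d \<in> D. l' c \<subseteq> m d}|" if "c \<in> C" for c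
      \<comment> \<open>At the new smallest threshold \<open>l c1\<close> all of \<open>C\<close>
        counts; \<open>CC'\<close> reduces this to \<open>C'\<close>, where the assumption for
        \<open>c1\<close> applies. At larger thresholds the counted sets are the old ones.\<close>
      proof (cases "l' c = l c1")
        case True
        have "|{c' \<in> C. l' c \<subseteq> l' c'}| \<le>o |C|" by (rule card_of_mono1) auto
        also note CC'
        also have "|C'| \<le>o |{c \<in> C. l c1 \<subseteq> l c}|"
          using c1(2) by (intro card_of_mono1) (auto simp: C'_def)
        also have "|{c \<in> C. l c1 \<subseteq> l c}| \<le>o |{d \<in> D. l c1 \<subseteq> m d}|"
          using c1 le by (simp add: C'_def)
        finally show ?thesis using True by simp
      next
        case False
        then have lc: "l c \<noteq> l c0" "l' c = l c" by (auto simp: l'_def split: if_splits)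
        then have "c \<in> C'" using that by (simp add: C'_def)
        then have "l c1 \<subset> l c" using c1(2) False lc by auto
        then have "{c' \<in> C. l' c \<subseteq> l' c'} = {c' \<in> C. l c \<subseteq> l c'}"
          using c0(2)[OF that] lc by (auto simp: l'_def)
        then show ?thesis using le[OF that] lc by simp
      qed
    qed
    then show ?thesis using l'_ge by (meson order_trans)
  qed
qed

text \<open>Row counts suffice. The values strictly below \<open>l c\<close> form a finite chain, so
  their union is still a proper subset of \<open>l c\<close>; a point \<open>x\<close> of
  \<open>l c\<close> outside it satisfies \<open>x \<in> t\<close> exactly when
  \<open>l c \<subseteq> t\<close>, for every value \<open>t\<close>.\<close>

lemma threshold_matching_pointwise:
  fixes l :: "'c \<Rightarrow> 'e set" and m :: "'d \<Rightarrow> 'e set"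
  assumes finl: "finite (l ` C)" and finm: "finite (m ` D)"
    and chain: "\<And>s t. s \<in> l ` C \<union> m ` D \<Longrightarrow> t \<in> l ` C \<union> m ` D \<Longrightarrow> s \<subseteq> t \<or> t \<subseteq> s"
    and ne: "\<And>c. c \<in> C \<Longrightarrow> l c \<noteq> {}"
    and le: "\<And>x. |{c \<in> C. x \<in> l c}| \<le>o |{d \<in> D. x \<in> m d}|"
  shows "\<exists>\<phi>. inj_on \<phi> C \<and> (\<forall>c\<in>C. \<phi> c \<in> D \<and> l c \<subseteq> m (\<phi> c))"
proof (rule threshold_matching[OF finl])
  fix c c' assume "c \<in> C" "c' \<in> C"
  then show "l c \<subseteq> l c' \<or> l c' \<subseteq> l c" using chain by blast
next
  fix c assume c: "c \<in> C"
  let ?L = "l ` C \<union> m ` D"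
  define T where "T = {t \<in> ?L. t \<subset> l c}"
  have "\<exists>x \<in> l c. \<forall>t\<in>T. x \<notin> t"
  proof (cases "T = {}")
    case True
    then show ?thesis using ne[OF c] by auto
  next
    case False
    have "finite T" using finl finm by (simp add: T_def)
    moreover have "s \<subseteq> t \<or> t \<subseteq> s" if "s \<in> T" "t \<in> T" for s t
      using that by (intro chain) (auto simp: T_def)
    ultimately have u: "\<Union>T \<in> T" using finite_chain_Inter_Union[of T] False by simp
    then have "\<Union>T \<subset> l c" by (simp add: T_def)
    then show ?thesis by blast
  qed
  then obtain x where x: "x \<in> l c" "\<forall>t\<in>T. x \<notin> t" ..
  have iff: "x \<in> t \<longleftrightarrow> l c \<subseteq> t" if t: "t \<in> ?L" for t
  proof
    assume "x \<in> t"
    then have "t \<notin> T" using x(2) by blast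
    then have "\<not> t \<subset> l c" using t by (auto simp: T_def)
    moreover have "t \<subseteq> l c \<or> l c \<subseteq> t" using chain[OF t] c by simp
    ultimately show "l c \<subseteq> t" by auto
  next
    assume "l c \<subseteq> t"
    with x(1) show "x \<in> t" by (rule subsetD[rotated])
  qed
  have "{c' \<in> C. l c \<subseteq> l c'} = {c' \<in> C. x \<in> l c'}" "{d \<in> D. l c \<subseteq> m d} = {d \<in> D. x \<in> m d}"
    using iff by auto
  then show "|{c' \<in> C. l c \<subseteq> l c'}| \<le>o |{d \<in> D. l c \<subseteq> m d}|" using le[of x] by simp
qed

section \<open>Disjoint unions of well-orders\<close>

text \<open>All components are realised as subsets of one well-order \<open>w\<close>, indexed by
  columns \<open>j\<close>. Lengths of components that are segments of \<open>w\<close> are then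
  compared by inclusion.\<close>

definition stack_order :: "'w rel \<Rightarrow> ('j \<times> 'w) rel" where
  "stack_order w = {((j, x), (j, y)) | j x y. (x, y) \<in> w}"

lemma in_stack_order [simp]: "((j, x), (k, y)) \<in> stack_order w \<longleftrightarrow> j = k \<and> (x, y) \<in> w"
  by (auto simp: stack_order_def)

text \<open>Empty columns are exempt from injectivity, because \<open>K\<close> need not have room
  for them.\<close>

lemma stack_embedsI:
  assumes inj: "inj_on \<phi> {j \<in> J. X j \<noteq> {}}"
    and K: "\<And>j. j \<in> J \<Longrightarrow> X j \<noteq> {} \<Longrightarrow> \<phi> j \<in> K"
    and emb: "\<And>j. j \<in> J \<Longrightarrow> X j \<noteq> {} \<Longrightarrow> order_embeds (X j) w (Y (\<phi> j)) w"
  shows "order_embeds (Sigma J X) (stack_order w) (Sigma K Y) (stack_order w)"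
proof -
  have "\<exists>f. inj_on f (X j) \<and> f ` X j \<subseteq> Y (\<phi> j) \<and> (\<forall>x\<in>X j. \<forall>y\<in>X j. (x, y) \<in> w \<longleftrightarrow> (f x, f y) \<in> w)"
    if "j \<in> J" "X j \<noteq> {}" for j
  proof -
    from emb[OF that] obtain f where "inj_on f (X j)" "\<And>x. x \<in> X j \<Longrightarrow> f x \<in> Y (\<phi> j)"
      "\<And>x y. x \<in> X j \<Longrightarrow> y \<in> X j \<Longrightarrow> (x, y) \<in> w \<longleftrightarrow> (f x, f y) \<in> w"
      by (rule order_embedsE) blast
    then show ?thesis by (intro exI[of _ f]) auto
  qed
  then obtain f where f: "\<And>j. j \<in> J \<Longrightarrow> X j \<noteq> {} \<Longrightarrow> inj_on (f j) (X j) \<and> f j ` X j \<subseteq> Y (\<phi> j)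
      \<and> (\<forall>x\<in>X j. \<forall>y\<in>X j. (x, y) \<in> w \<longleftrightarrow> (f j x, f j y) \<in> w)"
    by metis
  show ?thesis
  proof (rule order_embedsI[of "\<lambda>(j, x). (\<phi> j, f j x)"])
    show "inj_on (\<lambda>(j, x). (\<phi> j, f j x)) (Sigma J X)"
    proof (rule inj_onI, clarsimp)
      fix j x k y
      assume *: "j \<in> J" "x \<in> X j" "k \<in> J" "y \<in> X k" "\<phi> j = \<phi> k" "f j x = f k y"
      then have "j = k" by (intro inj_onD[OF inj]) auto
      with * f[of j] show "j = k \<and> x = y" by (auto dest: inj_onD)
    qed
    fix p assume "p \<in> Sigma J X"
    then show "(case p of (j, x) \<Rightarrow> (\<phi> j, f j x)) \<in> Sigma K Y" using K f by fastforce
  next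
    fix p q assume "p \<in> Sigma J X" "q \<in> Sigma J X"
    then obtain j x k y where *: "p = (j, x)" "q = (k, y)" "j \<in> J" "x \<in> X j" "k \<in> J" "y \<in> X k"
      by auto
    have "j = k" if "\<phi> j = \<phi> k" using * that by (intro inj_onD[OF inj]) auto
    with * f[of j] show "(p, q) \<in> stack_order w \<longleftrightarrow>
        ((case p of (j, x) \<Rightarrow> (\<phi> j, f j x)), (case q of (j, x) \<Rightarrow> (\<phi> j, f j x))) \<in> stack_order w"
      by auto
  qed
qed

text \<open>A column is a chain and different columns are incomparable, so \<open>f\<close> sends
  each column into a single one. Two columns cannot share a target, since the target is a chain and
  \<open>f\<close> reflects comparability.\<close>

lemma stack_embedsD:
  assumes w: "Well_order w"
    and emb: "order_embeds (Sigma J X) (stack_order w) (Sigma K Y) (stack_order w)"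
    and X: "\<And>j. j \<in> J \<Longrightarrow> X j \<subseteq> Field w" and Y: "\<And>j. j \<in> K \<Longrightarrow> Y j \<subseteq> Field w"
  obtains \<phi> where "inj_on \<phi> {j \<in> J. X j \<noteq> {}}"
    "\<And>j. j \<in> J \<Longrightarrow> X j \<noteq> {} \<Longrightarrow> \<phi> j \<in> K \<and> order_embeds (X j) w (Y (\<phi> j)) w"
proof -
  obtain f where inj: "inj_on f (Sigma J X)" and fY: "\<And>p. p \<in> Sigma J X \<Longrightarrow> f p \<in> Sigma K Y"
    and f: "\<And>p q. p \<in> Sigma J X \<Longrightarrow> q \<in> Sigma J X \<Longrightarrow>
      (p, q) \<in> stack_order w \<longleftrightarrow> (f p, f q) \<in> stack_order w"
    using emb by (rule order_embedsE) blast
  define \<phi> where "\<phi> j = fst (f (j, SOME x. x \<in> X j))" for j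
  have some: "(SOME x. x \<in> X j) \<in> X j" if "X j \<noteq> {}" for j
    using that by (simp add: some_in_eq)
  have fst_f: "fst (f (j, x)) = \<phi> j" if j: "j \<in> J" and x: "x \<in> X j" for j x
  proof -
    define y where "y = (SOME x. x \<in> X j)"
    have y: "y \<in> X j" unfolding y_def using some x by blast
    have "(x, y) \<in> w \<or> (y, x) \<in> w"
      using Well_order_total[OF w] X[OF j] x y by blast
    then have "(f (j, x), f (j, y)) \<in> stack_order w \<or> (f (j, y), f (j, x)) \<in> stack_order w"
      using f[of "(j, x)" "(j, y)"] f[of "(j, y)" "(j, x)"] j x y by simp
    then show ?thesis unfolding \<phi>_def y_def[symmetric]
      by (cases "f (j, x)"; cases "f (j, y)") auto
  qed
  show ?thesis
  proof (rule that[of \<phi>])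
    show "inj_on \<phi> {j \<in> J. X j \<noteq> {}}"
    proof (rule inj_onI)
      fix j k assume "j \<in> {j \<in> J. X j \<noteq> {}}" "k \<in> {j \<in> J. X j \<noteq> {}}" and eq: "\<phi> j = \<phi> k"
      then obtain x y where *: "j \<in> J" "x \<in> X j" "k \<in> J" "y \<in> X k" by blast
      obtain a b where ab: "f (j, x) = (\<phi> j, a)" "f (k, y) = (\<phi> j, b)"
        using fst_f[of j x] fst_f[of k y] * eq by (metis prod.collapse)
      have "a \<in> Field w" "b \<in> Field w"
        using fY[of "(j, x)"] fY[of "(k, y)"] * ab Y by auto
      then have "(f (j, x), f (k, y)) \<in> stack_order w \<or> (f (k, y), f (j, x)) \<in> stack_order w"
        using Well_order_total[OF w, of a b] ab by simp
      then show "j = k" using f[of "(j, x)" "(k, y)"] f[of "(k, y)" "(j, x)"] * by auto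
    qed
    fix j assume j: "j \<in> J" "X j \<noteq> {}"
    then obtain x where x: "x \<in> X j" by blast
    have fe: "f (j, y) = (\<phi> j, snd (f (j, y)))" if "y \<in> X j" for y
      using fst_f[OF j(1) that] by (metis prod.collapse)
    have "\<phi> j \<in> K" using fY[of "(j, x)"] fe[OF x] j x by (metis SigmaD1 SigmaI)
    moreover have "order_embeds (X j) w (Y (\<phi> j)) w"
    proof (rule order_embedsI[of "\<lambda>y. snd (f (j, y))"])
      show "inj_on (\<lambda>y. snd (f (j, y))) (X j)"
      proof (rule inj_onI)
        fix y z assume yz: "y \<in> X j" "z \<in> X j" "snd (f (j, y)) = snd (f (j, z))"
        then have "f (j, y) = f (j, z)" using fe by metis
        then have "(j, y) = (j, z)" using yz j by (intro inj_onD[OF inj]) auto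
        then show "y = z" by simp
      qed
      show "snd (f (j, y)) \<in> Y (\<phi> j)" if "y \<in> X j" for y
        using fY[of "(j, y)"] fe[OF that] j that by (metis SigmaD2 SigmaI)
      show "(y, z) \<in> w \<longleftrightarrow> (snd (f (j, y)), snd (f (j, z))) \<in> w" if "y \<in> X j" "z \<in> X j" for y z
      proof -
        have "(y, z) \<in> w \<longleftrightarrow> (f (j, y), f (j, z)) \<in> stack_order w"
          using f[of "(j, y)" "(j, z)"] that j by simp
        also have "\<dots> \<longleftrightarrow> (snd (f (j, y)), snd (f (j, z))) \<in> w"
          by (subst (1) fe[OF that(1)], subst (1) fe[OF that(2)]) simp
        finally show ?thesis .
      qed
    qed
    ultimately show "\<phi> j \<in> K \<and> order_embeds (X j) w (Y (\<phi> j)) w" ..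
  qed
qed

lemma ofilter_chain:
  assumes "Well_order w" "ofilter w E" "ofilter w E'"
  shows "E \<subseteq> E' \<or> E' \<subseteq> E"
  using assms wo_rel.ofilter_linord[of w] by (simp add: wo_rel_def)

text \<open>The rank \<open>rk j\<close> is the number of values of \<open>H\<close> strictly larger
  than \<open>H j\<close>, finite by assumption. Sorting by rank, with ties broken by an arbitrary
  well-order, puts larger values first.\<close>

lemma antimono_well_order:
  assumes fin: "finite (H ` J)"
  obtains s where "well_order_on J s" "\<And>j k. (j, k) \<in> s \<Longrightarrow> \<not> H j \<subset> H k"
proof -
  obtain s0 where s0: "well_order_on J s0" using well_order_on by blast
  define rk where "rk j = card {E \<in> H ` J. H j \<subset> E}" for j
  define s where "s = {(j, k). j \<in> J \<and> k \<in> J \<and> (rk j < rk k \<or> rk j = rk k \<and> (j, k) \<in> s0)}"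
  have rk: "rk k < rk j" if "H j \<subset> H k" "k \<in> J" for j k
    unfolding rk_def
  proof (rule psubset_card_mono)
    show "{E \<in> H ` J. H k \<subset> E} \<subset> {E \<in> H ` J. H j \<subset> E}" using that by auto
  qed (use fin in simp)
  have lin: "refl_on J s0" "trans s0" "antisym s0" "total_on J s0" "wf (s0 - Id)"
    using s0 by (simp_all add: order_on_defs)
  have "well_order_on J s"
    unfolding order_on_defs
  proof (intro conjI)
    show "s \<subseteq> J \<times> J" by (auto simp: s_def)
    show "refl_on J s" using lin(1) by (auto simp: s_def refl_on_def)
    show "trans s" by (rule transI) (auto simp: s_def dest: transD[OF lin(2)])
    show "antisym s" using antisymD[OF lin(3)] by (force simp: s_def intro!: antisymI)
    show "total_on J s" using lin(4) by (force simp: s_def total_on_def)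
    have "wf (inv_image (less_than <*lex*> (s0 - Id)) (\<lambda>j. (rk j, j)))"
      using lin(5) by (intro wf_inv_image wf_lex_prod wf_less_than)
    then show "wf (s - Id)" by (rule wf_subset) (auto simp: s_def inv_image_def)
  qed
  moreover have "\<not> H j \<subset> H k" if "(j, k) \<in> s" for j k
  proof
    assume "H j \<subset> H k"
    then have "rk k < rk j" using that by (intro rk) (simp_all add: s_def)
    then show False using that by (simp add: s_def)
  qed
  ultimately show ?thesis using that by blast
qed

text \<open>\<open>J0\<close> and \<open>S\<close> express the pinboard condition: outside finitely
  many columns, all columns lie in one finite set. The representing map replaces each column of
  \<open>X\<close> by an equimorphic segment and then pushes every row to the front of the list
  \<open>s\<close> of columns.\<close>

lemma sub_representable_stack:
  assumes w: "Well_order w" and H: "\<And>j. j \<in> J \<Longrightarrow> ofilter w (H j)"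
    and J0: "finite J0" and S: "finite S" and HS: "\<And>j. j \<in> J - J0 \<Longrightarrow> H j \<subseteq> S"
  shows "sub_representable (Sigma J H) (stack_order w)"
proof -
  \<comment> \<open>One subset of each column yields finitely many sets altogether: finitely many
    from \<open>J0\<close>, and subsets of \<open>S\<close> from the rest. This bounds the number of
    lengths in \<open>H\<close>, \<open>l X\<close> and \<open>m X\<close>.\<close>
  have fin: "finite (E ` J)" if "\<And>j. j \<in> J \<Longrightarrow> E j \<subseteq> H j" for E
  proof (rule finite_subset)
    show "E ` J \<subseteq> E ` J0 \<union> Pow S" using that HS by blast
  qed (use J0 S in simp)
  obtain s where s: "well_order_on J s" and anti: "\<And>j k. (j, k) \<in> s \<Longrightarrow> \<not> H j \<subset> H k"
    by (rule antimono_well_order[OF fin[of H]]) auto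
  have sF: "Field s = J" "Well_order s" using s well_order_on_Well_order by blast+
  have dec: "H k \<subseteq> H j" if "(j, k) \<in> s" for j k
  proof -
    have "j \<in> J" "k \<in> J" using that sF(1) by (auto simp: Field_def)
    then show ?thesis using anti[OF that] ofilter_chain[OF w H H] by blast
  qed
  obtain e where e: "\<And>X. X \<subseteq> Field w \<Longrightarrow>
      ofilter w (e X) \<and> order_embeds X w (e X) w \<and> order_embeds (e X) w X w"
    using subset_equimorphic_ofilter[OF w] by metis
  have HF: "H j \<subseteq> Field w" if "j \<in> J" for j using H[OF that] by (simp add: ofilter_def)
  \<comment> \<open>\<open>l X j\<close> is the normalised column, \<open>N X x\<close> the set of
    columns that reach height \<open>x\<close>, and \<open>m X j\<close> the column after row
    \<open>x\<close> has been replaced by the least segment of \<open>s\<close> of the same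
    cardinality.\<close>
  define l where "l X j = e (X `` {j})" for X :: "('b \<times> 'a) set" and j
  define N where "N X x = {j \<in> J. x \<in> l X j}" for X x
  define m where "m X j = {x. j \<in> cardinal_segment s (N X x)}" for X j
  define g where "g X = Sigma J (m X)" for X
  have SX: "X = Sigma J (\<lambda>j. X `` {j})" if "X \<subseteq> Sigma J H" for X
    using that by auto
  have colH: "X `` {j} \<subseteq> H j" if "X \<subseteq> Sigma J H" for X j using that by auto
  have col: "X `` {j} \<subseteq> Field w" if "X \<subseteq> Sigma J H" for X j
    using that HF by (cases "j \<in> J") auto
  have l: "ofilter w (l X j)" "order_embeds (X `` {j}) w (l X j) w" "order_embeds (l X j) w (X `` {j}) w"
    if "X \<subseteq> Sigma J H" for X j
    using e[OF col[OF that]] by (simp_all add: l_def)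
  have lH: "l X j \<subseteq> H j" if "X \<subseteq> Sigma J H" "j \<in> J" for X j
    using order_embeds_trans[OF l(3)[OF that(1)] order_embeds_subset[OF colH[OF that(1)]]]
    by (rule ofilter_embeds_imp_subset[OF w l(1)[OF that(1)] H[OF that(2)]])
  have l_empty: "l X j = {} \<longleftrightarrow> X `` {j} = {}" if "X \<subseteq> Sigma J H" for X j
    using l(2,3)[OF that, of j] order_embeds_empty by metis
  have NJ: "N X x \<subseteq> Field s" for X x by (auto simp: N_def sF)
  have seg: "ofilter s (cardinal_segment s (N X x))" "|cardinal_segment s (N X x)| =o |N X x|" for X x
    by (rule cardinal_segment[OF sF(2) NJ])+
  have row: "{j \<in> J. x \<in> m X j} = cardinal_segment s (N X x)" for X x
    using seg(1)[of X x] by (auto simp: m_def ofilter_def sF)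
  have mH: "m X j \<subseteq> H j" if X: "X \<subseteq> Sigma J H" and j: "j \<in> J" for X j
  proof
    fix x assume "x \<in> m X j"
    \<comment> \<open>Since \<open>s\<close> lists longer columns first, the columns of the full
      poset that reach \<open>x\<close> form a segment of \<open>s\<close>. It is large enough for
      row \<open>x\<close>, so the least such segment stays inside it.\<close>
    moreover have "cardinal_segment s (N X x) \<subseteq> {j \<in> J. x \<in> H j}"
    proof (rule cardinal_segment_subset)
      show "ofilter s {j \<in> J. x \<in> H j}"
        unfolding ofilter_def under_def using dec FieldI1[of _ _ s] by (auto simp: sF)
      show "|N X x| \<le>o |{j \<in> J. x \<in> H j}|"
        using lH[OF X] by (intro card_of_mono1) (auto simp: N_def)
    qed
    ultimately show "x \<in> H j" by (auto simp: m_def)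
  qed
  have m: "ofilter w (m X j)" if X: "X \<subseteq> Sigma J H" and j: "j \<in> J" for X j
    unfolding ofilter_def under_def
  proof (intro conjI ballI subsetI; clarsimp?)
    show "x \<in> Field w" if "x \<in> m X j" for x using that mH[OF X j] HF[OF j] by blast
    fix x y assume x: "x \<in> m X j" and yx: "(y, x) \<in> w"
    have "N X x \<subseteq> N X y" using ofilterD[OF l(1)[OF X] _ yx] by (auto simp: N_def)
    then have "cardinal_segment s (N X x) \<subseteq> cardinal_segment s (N X y)"
      by (intro cardinal_segment_mono card_of_mono1)
    with x show "y \<in> m X j" by (auto simp: m_def)
  qed
  have chain: "E \<subseteq> E' \<or> E' \<subseteq> E"
    if X: "X \<subseteq> Sigma J H" and "E \<in> l X ` J \<union> m X ` J" "E' \<in> l X ` J \<union> m X ` J" for X E E'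
  proof (rule ofilter_chain[OF w])
    show "ofilter w E" "ofilter w E'" using that l(1)[OF X] m[OF X] by auto
  qed
  have finl: "finite (l X ` J)" and finm: "finite (m X ` J)" if "X \<subseteq> Sigma J H" for X
    using fin lH[OF that] mH[OF that] by blast+
  show ?thesis
  proof (rule sub_representableI[of _ g])
    fix X assume X: "X \<subseteq> Sigma J H"
    show "g X \<subseteq> Sigma J H" using mH[OF X] by (auto simp: g_def)
    \<comment> \<open>Corresponding rows of \<open>l X\<close> and \<open>m X\<close> have equal
      cardinality, so the matching lemma applies in both directions; here columns of
      \<open>l X\<close> are placed into columns of \<open>m X\<close>.\<close>
    have "\<exists>\<phi>. inj_on \<phi> {j \<in> J. l X j \<noteq> {}} \<and>
        (\<forall>j\<in>{j \<in> J. l X j \<noteq> {}}. \<phi> j \<in> J \<and> l X j \<subseteq> m X (\<phi> j))"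
    proof (rule threshold_matching_pointwise)
      show "finite (l X ` {j \<in> J. l X j \<noteq> {}})"
        by (rule finite_subset[OF _ finl[OF X]]) auto
      show "finite (m X ` J)" by (rule finm[OF X])
      show "E \<subseteq> E' \<or> E' \<subseteq> E"
        if "E \<in> l X ` {j \<in> J. l X j \<noteq> {}} \<union> m X ` J" "E' \<in> l X ` {j \<in> J. l X j \<noteq> {}} \<union> m X ` J" for E E'
        using that by (intro chain[OF X]) auto
      fix x
      have "{j \<in> {j \<in> J. l X j \<noteq> {}}. x \<in> l X j} = N X x" by (auto simp: N_def)
      then show "|{j \<in> {j \<in> J. l X j \<noteq> {}}. x \<in> l X j}| \<le>o |{j \<in> J. x \<in> m X j}|"
        using seg(2)[of X x] by (simp add: row ordIso_iff_ordLeq)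
    qed simp
    then obtain \<phi> where \<phi>: "inj_on \<phi> {j \<in> J. l X j \<noteq> {}}"
      "\<And>j. j \<in> J \<Longrightarrow> l X j \<noteq> {} \<Longrightarrow> \<phi> j \<in> J \<and> l X j \<subseteq> m X (\<phi> j)" by auto
    have "order_embeds (Sigma J (\<lambda>j. X `` {j})) (stack_order w) (Sigma J (m X)) (stack_order w)"
    proof (rule stack_embedsI[of \<phi>])
      show "inj_on \<phi> {j \<in> J. X `` {j} \<noteq> {}}" using \<phi>(1) l_empty[OF X] by simp
      fix j assume j: "j \<in> J" "X `` {j} \<noteq> {}"
      then have *: "\<phi> j \<in> J" "l X j \<subseteq> m X (\<phi> j)" using \<phi>(2) l_empty[OF X] by simp_all
      show "\<phi> j \<in> J" by fact
      show "order_embeds (X `` {j}) w (m X (\<phi> j)) w"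
        using l(2)[OF X] order_embeds_subset[OF *(2)] by (rule order_embeds_trans)
    qed
    then show "order_embeds X (stack_order w) (g X) (stack_order w)"
      using SX[OF X] by (simp add: g_def)
    have "\<exists>\<phi>. inj_on \<phi> {j \<in> J. m X j \<noteq> {}} \<and>
        (\<forall>j\<in>{j \<in> J. m X j \<noteq> {}}. \<phi> j \<in> J \<and> m X j \<subseteq> l X (\<phi> j))"
    proof (rule threshold_matching_pointwise)
      show "finite (m X ` {j \<in> J. m X j \<noteq> {}})"
        by (rule finite_subset[OF _ finm[OF X]]) auto
      show "finite (l X ` J)" by (rule finl[OF X])
      show "E \<subseteq> E' \<or> E' \<subseteq> E"
        if "E \<in> m X ` {j \<in> J. m X j \<noteq> {}} \<union> l X ` J" "E' \<in> m X ` {j \<in> J. m X j \<noteq> {}} \<union> l X ` J" for E E'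
        using that by (intro chain[OF X]) auto
      fix x
      have "{j \<in> {j \<in> J. m X j \<noteq> {}}. x \<in> m X j} = {j \<in> J. x \<in> m X j}" by auto
      moreover have "{j \<in> J. x \<in> l X j} = N X x" by (simp add: N_def)
      ultimately show "|{j \<in> {j \<in> J. m X j \<noteq> {}}. x \<in> m X j}| \<le>o |{j \<in> J. x \<in> l X j}|"
        using seg(2)[of X x] by (simp add: row ordIso_iff_ordLeq)
    qed simp
    then obtain \<psi> where \<psi>: "inj_on \<psi> {j \<in> J. m X j \<noteq> {}}"
      "\<And>j. j \<in> J \<Longrightarrow> m X j \<noteq> {} \<Longrightarrow> \<psi> j \<in> J \<and> m X j \<subseteq> l X (\<psi> j)" by auto
    have "order_embeds (Sigma J (m X)) (stack_order w) (Sigma J (\<lambda>j. X `` {j})) (stack_order w)"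
    proof (rule stack_embedsI[OF \<psi>(1)])
      fix j assume j: "j \<in> J" "m X j \<noteq> {}"
      show "\<psi> j \<in> J" using \<psi>(2)[OF j] ..
      have "m X j \<subseteq> l X (\<psi> j)" using \<psi>(2)[OF j] ..
      from order_embeds_subset[OF this] l(3)[OF X]
      show "order_embeds (m X j) w (X `` {\<psi> j}) w" by (rule order_embeds_trans)
    qed
    then show "order_embeds (g X) (stack_order w) X (stack_order w)"
      using SX[OF X] by (simp add: g_def)
  next
    fix X Y :: "('b \<times> 'a) set"
    assume X: "X \<subseteq> Sigma J H" and Y: "Y \<subseteq> Sigma J H"
      and emb: "order_embeds X (stack_order w) Y (stack_order w)"
    have "order_embeds (Sigma J (\<lambda>j. X `` {j})) (stack_order w) (Sigma J (\<lambda>j. Y `` {j})) (stack_order w)"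
      using emb SX[OF X] SX[OF Y] by simp
    then obtain \<phi> where \<phi>: "inj_on \<phi> {j \<in> J. X `` {j} \<noteq> {}}"
      "\<And>j. j \<in> J \<Longrightarrow> X `` {j} \<noteq> {} \<Longrightarrow> \<phi> j \<in> J \<and> order_embeds (X `` {j}) w (Y `` {\<phi> j}) w"
      using col[OF X] col[OF Y] by (rule stack_embedsD[OF w]) blast
    \<comment> \<open>An embedding sends distinct non-empty columns into distinct columns that are
      at least as long, hence row \<open>x\<close> of \<open>X\<close> injects into row
      \<open>x\<close> of \<open>Y\<close>.\<close>
    have "cardinal_segment s (N X x) \<subseteq> cardinal_segment s (N Y x)" for x
    proof (rule cardinal_segment_mono)
      have N_sub: "N X x \<subseteq> {j \<in> J. X `` {j} \<noteq> {}}"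
        using l_empty[OF X] by (auto simp: N_def)
      have "\<phi> j \<in> N Y x" if "j \<in> N X x" for j
      proof -
        have j: "j \<in> J" "X `` {j} \<noteq> {}" "x \<in> l X j" using that N_sub by (auto simp: N_def)
        have "order_embeds (l X j) w (X `` {j}) w" by (rule l(3)[OF X])
        also have "order_embeds (X `` {j}) w (Y `` {\<phi> j}) w" using \<phi>(2) j by blast
        also have "order_embeds (Y `` {\<phi> j}) w (l Y (\<phi> j)) w" by (rule l(2)[OF Y])
        finally have "l X j \<subseteq> l Y (\<phi> j)" by (rule ofilter_embeds_imp_subset[OF w l(1)[OF X] l(1)[OF Y]])
        then show ?thesis using j \<phi>(2) by (auto simp: N_def)
      qed
      then have "\<phi> ` N X x \<subseteq> N Y x" by blast
      moreover have "inj_on \<phi> (N X x)" using \<phi>(1) N_sub by (rule inj_on_subset)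
      ultimately show "|N X x| \<le>o |N Y x|" unfolding card_of_ordLeq[symmetric] by blast
    qed
    then show "g X \<subseteq> g Y" unfolding g_def m_def by blast
  qed
qed

section \<open>Boards as stacks over their longest order\<close>

lemma finite_has_ordLeq_maximum:
  assumes "finite R" "R \<noteq> {}" "\<And>r. r \<in> R \<Longrightarrow> Well_order r"
  shows "\<exists>m\<in>R. \<forall>r\<in>R. r \<le>o m"
  using assms
proof (induction rule: finite_ne_induct)
  case (singleton r)
  then show ?case by (simp add: ordLeq_reflexive)
next
  case (insert r R)
  then obtain m where m: "m \<in> R" "\<And>q. q \<in> R \<Longrightarrow> q \<le>o m" by auto
  have "r \<le>o r" "Well_order r" "Well_order m"
    using insert.prems m(1) by (simp_all add: ordLeq_reflexive)
  then consider "r \<le>o m" | "m \<le>o r" using ordLeq_total by blast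
  then show ?case
  proof cases
    case 1
    with m show ?thesis by (intro bexI[of _ m]) auto
  next
    case 2
    with m \<open>r \<le>o r\<close> show ?thesis by (intro bexI[of _ r]) (auto intro: ordLeq_transitive)
  qed
qed

lemma sub_representable_empty: "sub_representable {} r"
  by (rule sub_representableI[of _ id]) (auto intro: order_embeds_subset)

text \<open>Every order of the board is a segment of its longest order \<open>w\<close>. Infinite
  orders have finitely many copies, which form the exceptional columns; the finitely many finite
  orders have a finite union.\<close>

lemma sub_representable_board:
  fixes B :: "('b rel \<times> 'c rel) set"
  assumes B: "pinboard B"
  shows "sub_representable (board_carrier B) (board_order B)"
proof (cases "B = {}")
  case True
  then show ?thesis by (simp add: board_carrier_def sub_representable_empty)
next
  case False
  have finB: "finite B" using B by (simp add: pinboard_def)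
  have wo: "Well_order (fst b)" if "b \<in> B" for b
    using B that by (cases b) (auto simp: pinboard_def)
  have not_both: "finite (Field (fst b)) \<or> finite (Field (snd b))" if "b \<in> B" for b
    using B that by (cases b) (auto simp: pinboard_def)
  obtain w where w: "w \<in> fst ` B" "\<And>h. h \<in> fst ` B \<Longrightarrow> h \<le>o w"
    using finite_has_ordLeq_maximum[of "fst ` B"] finB False wo by blast
  have ww: "Well_order w" using w(1) wo by blast
  have "\<exists>f. inj_on f (Field h) \<and> ofilter w (f ` Field h) \<and>
      (\<forall>x\<in>Field h. \<forall>y\<in>Field h. (x, y) \<in> h \<longleftrightarrow> (f x, f y) \<in> w)" if "h \<in> fst ` B" for h
    using w(2)[OF that] by (rule ordLeq_ofilter_iso) blast
  then obtain e where e: "\<And>h. h \<in> fst ` B \<Longrightarrow> inj_on (e h) (Field h) \<and> ofilter w (e h ` Field h) \<and>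
      (\<forall>x\<in>Field h. \<forall>y\<in>Field h. (x, y) \<in> h \<longleftrightarrow> (e h x, e h y) \<in> w)"
    by metis
  define J where "J = (SIGMA b:B. Field (snd b))"
  define H where "H = (\<lambda>(b :: 'b rel \<times> 'c rel, c :: 'c). e (fst b) ` Field (fst b))"
  have "sub_representable (Sigma J H) (stack_order w)"
  proof (rule sub_representable_stack[OF ww])
    show "ofilter w (H j)" if "j \<in> J" for j
      using that e by (auto simp: J_def H_def)
    show "finite (SIGMA b:{b \<in> B. infinite (Field (fst b))}. Field (snd b))"
      using finB not_both by (intro finite_SigmaI) auto
    show "finite (\<Union>b\<in>{b \<in> B. finite (Field (fst b))}. e (fst b) ` Field (fst b))"
      using finB by simp
    fix j assume "j \<in> J - (SIGMA b:{b \<in> B. infinite (Field (fst b))}. Field (snd b))"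
    then show "H j \<subseteq> (\<Union>b\<in>{b \<in> B. finite (Field (fst b))}. e (fst b) ` Field (fst b))"
      by (auto simp: J_def H_def)
  qed
  moreover have "order_isomorphic (board_carrier B) (board_order B) (Sigma J H) (stack_order w)"
    unfolding order_isomorphic_def
  proof (intro exI[of _ "\<lambda>(b, c, x). ((b, c), e (fst b) x)"] conjI ballI)
    show "bij_betw (\<lambda>(b, c, x). ((b, c), e (fst b) x)) (board_carrier B) (Sigma J H)"
      unfolding bij_betw_def
    proof
      show "inj_on (\<lambda>(b, c, x). ((b, c), e (fst b) x)) (board_carrier B)"
        using e by (force simp: inj_on_def board_carrier_def)
      show "(\<lambda>(b, c, x). ((b, c), e (fst b) x)) ` board_carrier B = Sigma J H"
        by (force simp: board_carrier_def J_def H_def image_iff)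
    qed
    fix p q assume "p \<in> board_carrier B" "q \<in> board_carrier B"
    then obtain b c x b' c' y where pq: "p = (b, c, x)" "q = (b', c', y)"
      "b \<in> B" "b' \<in> B" "c \<in> Field (snd b)" "c' \<in> Field (snd b')" "x \<in> Field (fst b)" "y \<in> Field (fst b')"
      by (force simp: board_carrier_def)
    then have "(p, q) \<in> board_order B \<longleftrightarrow> b = b' \<and> c = c' \<and> (x, y) \<in> fst b"
      by (cases b; cases b') (auto simp: board_order_def)
    with pq e[of "fst b"] show "(p, q) \<in> board_order B \<longleftrightarrow>
      (case p of (b, c, x) \<Rightarrow> ((b, c), e (fst b) x), case q of (b, c, x) \<Rightarrow> ((b, c), e (fst b) x)) \<in> stack_order w"
      by auto
  qed
  ultimately show ?thesis using sub_representable_iso by blast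
qed

lemma sub_representable_if_pinboard_poset: "pinboard_poset A r \<Longrightarrow> sub_representable A r"
  unfolding pinboard_poset_def using sub_representable_iso sub_representable_board by blast

section \<open>Co-flowers\<close>

lemma order_embeds_cong_rel:
  assumes "order_embeds X r Y s"
    and r: "\<And>x y. x \<in> X \<Longrightarrow> y \<in> X \<Longrightarrow> (x, y) \<in> r' \<longleftrightarrow> (x, y) \<in> r"
    and s: "\<And>x y. x \<in> Y \<Longrightarrow> y \<in> Y \<Longrightarrow> (x, y) \<in> s' \<longleftrightarrow> (x, y) \<in> s"
  shows "order_embeds X r' Y s'"
proof -
  obtain f where f: "inj_on f X" "\<And>x. x \<in> X \<Longrightarrow> f x \<in> Y"
    "\<And>x y. x \<in> X \<Longrightarrow> y \<in> X \<Longrightarrow> (x, y) \<in> r \<longleftrightarrow> (f x, f y) \<in> s"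
    using assms(1) by (rule order_embedsE) blast
  show ?thesis
    by (rule order_embedsI[OF f(1,2)]) (simp_all add: f r s)
qed

lemma order_embeds_Restr:
  assumes "X \<subseteq> C" "Y \<subseteq> C"
  shows "order_embeds X (Restr r C) Y (Restr r C) \<longleftrightarrow> order_embeds X r Y r"
proof
  assume "order_embeds X (Restr r C) Y (Restr r C)"
  then show "order_embeds X r Y r"
    by (rule order_embeds_cong_rel) (use assms in auto)
next
  assume "order_embeds X r Y r"
  then show "order_embeds X (Restr r C) Y (Restr r C)"
    by (rule order_embeds_cong_rel) (use assms in auto)
qed

lemma well_order_on_Restr_if_well_ordered_chain:
  assumes r: "partial_order_on A r" and X: "X \<subseteq> A" and wo: "well_ordered_chain_on X r"
  shows "well_order_on X (Restr r X)"
  unfolding order_on_defs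
proof (intro conjI)
  have r': "refl_on A r" "trans r" "antisym r" using r by (simp_all add: order_on_defs)
  show "Restr r X \<subseteq> X \<times> X" by blast
  show "refl_on X (Restr r X)" using r'(1) X by (auto simp: refl_on_def)
  show "trans (Restr r X)" by (rule trans_Restr[OF r'(2)])
  show "antisym (Restr r X)" by (rule antisym_Restr[OF r'(3)])
  show "total_on X (Restr r X)" using wo by (auto simp: total_on_def well_ordered_chain_on_def chain_on_def)
  show "wf (Restr r X - Id)"
    unfolding wf_eq_minimal
  proof (intro allI impI)
    fix Q x assume "x \<in> (Q :: 'a set)"
    show "\<exists>z\<in>Q. \<forall>y. (y, z) \<in> Restr r X - Id \<longrightarrow> y \<notin> Q"
    proof (cases "Q \<inter> X = {}")
      case True
      then show ?thesis using \<open>x \<in> Q\<close> by blast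
    next
      case False
      then obtain m where m: "m \<in> Q \<inter> X" "\<And>y. y \<in> Q \<inter> X \<Longrightarrow> (m, y) \<in> r"
        using wo unfolding well_ordered_chain_on_def by (metis Int_lower2)
      then have "y \<notin> Q" if "(y, m) \<in> Restr r X - Id" for y
        using that antisymD[OF r'(3), of y m] by auto
      with m(1) show ?thesis by blast
    qed
  qed
qed

lemma well_ordered_chain_on_insert:
  assumes wo: "well_ordered_chain_on X r" and a: "(a, a) \<in> r" "\<And>x. x \<in> X \<Longrightarrow> (a, x) \<in> r"
  shows "well_ordered_chain_on (insert a X) r"
  unfolding well_ordered_chain_on_def
proof (intro conjI allI impI)
  show "chain_on (insert a X) r"
    using wo a unfolding well_ordered_chain_on_def chain_on_def by auto
  fix Y assume Y: "Y \<subseteq> insert a X" "Y \<noteq> {}"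
  show "\<exists>m\<in>Y. \<forall>y\<in>Y. (m, y) \<in> r"
  proof (cases "a \<in> Y")
    case True
    then show ?thesis using a Y by (intro bexI[of _ a]) auto
  next
    case False
    then have "Y \<subseteq> X" using Y by blast
    then show ?thesis using wo Y(2) by (simp add: well_ordered_chain_on_def)
  qed
qed

text \<open>The poset is an antichain \<open>V\<close> below a well-ordered chain \<open>C\<close>.
  A set with at most one point in \<open>V\<close> is a chain, and may be equimorphic to one without
  such a point, because an infinite well-order absorbs a new least element. With two points in
  \<open>V\<close>, the antichain part and the chain part are separate invariants.\<close>

lemma sub_representable_if_co_flower:
  assumes r: "partial_order_on A r" and fl: "co_flower A r"
  shows "sub_representable A r"
proof -
  obtain x where x: "x \<in> A" "well_ordered_chain_on (aboveS r x) r" "antichain_on (underS r x) r"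
    "\<exists>u\<in>underS r x. \<exists>v\<in>underS r x. u \<noteq> v" "underS r x \<union> aboveS r x \<union> {x} = A"
    using fl unfolding co_flower_def by blast
  have refl: "\<And>a. a \<in> A \<Longrightarrow> (a, a) \<in> r" and trans: "\<And>a b c. (a, b) \<in> r \<Longrightarrow> (b, c) \<in> r \<Longrightarrow> (a, c) \<in> r"
    and anti: "\<And>a b. (a, b) \<in> r \<Longrightarrow> (b, a) \<in> r \<Longrightarrow> a = b"
    using r by (auto simp: order_on_defs refl_on_def dest: antisymD transD)
  define V where "V = underS r x"
  define C where "C = insert x (aboveS r x)"
  have V: "a = b" if "a \<in> V" "b \<in> V" "(a, b) \<in> r" for a b
    using x(3) that by (auto simp: V_def antichain_on_def)
  have A: "A = C \<union> V" using x(5) by (auto simp: C_def V_def)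
  have VC: "(v, c) \<in> r" if "v \<in> V" "c \<in> C" for v c
    using that trans by (auto simp: V_def C_def underS_def aboveS_def)
  have disj: "C \<inter> V = {}"
    using anti by (auto simp: V_def C_def underS_def aboveS_def)
  have CV: "(c, v) \<notin> r" if "v \<in> V" "c \<in> C" for v c
    using VC[OF that] anti disj that by blast
  have wC: "well_ordered_chain_on C r"
    unfolding C_def by (rule well_ordered_chain_on_insert[OF x(2)]) (use refl x(1) in \<open>auto simp: aboveS_def\<close>)
  then have C: "(c, d) \<in> r \<or> (d, c) \<in> r" if "c \<in> C" "d \<in> C" for c d
    using that by (auto simp: well_ordered_chain_on_def chain_on_def)
  obtain s where s: "well_order_on V s" using well_order_on by blast
  have sF: "Well_order s" "Field s = V" using s well_order_on_Well_order by blast+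
  \<comment> \<open>As the \<open>s\<close>-least point of \<open>V\<close>, \<open>u0\<close> lies
    in every non-empty segment of \<open>s\<close>. This puts the canonical chains inside the
    canonical non-chains when they embed there.\<close>
  obtain u0 where u0: "u0 \<in> V" "\<And>v. v \<in> V \<Longrightarrow> (u0, v) \<in> s"
  proof -
    have "V \<noteq> {}" using x(4) by (auto simp: V_def)
    then obtain u where "u \<in> V" "\<And>v. (v, u) \<in> s - Id \<Longrightarrow> v \<notin> V"
      using s unfolding well_order_on_def wf_eq_minimal by (metis ex_in_conv)
    moreover have "(u, v) \<in> s" if "v \<in> V" for v
      using calculation that Well_order_total[OF sF(1), of u v] sF(2) by auto
    ultimately show ?thesis using that by blast
  qed
  text \<open>
    Chains are moved into \<open>insert u0 C\<close>; the other subsets are a segment of \<open>C\<close> together with a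
    cardinal segment of \<open>V\<close>, which contains \<open>u0\<close>.
  \<close>
  define w0 where "w0 = Restr r C"
  define w1 where "w1 = Restr r (insert u0 C)"
  have "well_order_on C w0"
    unfolding w0_def using A by (intro well_order_on_Restr_if_well_ordered_chain[OF r _ wC]) auto
  then have w0: "Well_order w0" "Field w0 = C" using well_order_on_Well_order by blast+
  have wC1: "well_ordered_chain_on (insert u0 C) r"
    by (rule well_ordered_chain_on_insert[OF wC]) (use refl u0 VC A in auto)
  have "well_order_on (insert u0 C) w1"
    unfolding w1_def using A u0 by (intro well_order_on_Restr_if_well_ordered_chain[OF r _ wC1]) auto
  then have w1: "Well_order w1" "Field w1 = insert u0 C" using well_order_on_Well_order by blast+
  have C1: "(c, d) \<in> r \<or> (d, c) \<in> r" if "c \<in> insert u0 C" "d \<in> insert u0 C" for c d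
    using that wC1 by (auto simp: well_ordered_chain_on_def chain_on_def)
  let ?K = "cardinal_segment s"
  have K: "ofilter s (?K M)" "|?K M| =o |M|" "?K M \<subseteq> V" if "M \<subseteq> V" for M
    using cardinal_segment[OF sF(1), of M] that by (auto simp: sF(2) ofilter_def)
  \<comment> \<open>All of \<open>V\<close> lies below all of \<open>C\<close>, so an embedding of
    the chain parts and an injection of the antichain parts combine freely.\<close>
  have emb_sum: "order_embeds (X1 \<union> X2) r (Y1 \<union> Y2) r"
    if sub: "X1 \<subseteq> C" "Y1 \<subseteq> C" "X2 \<subseteq> V" "Y2 \<subseteq> V"
      and emb: "order_embeds X1 r Y1 r" and le: "|X2| \<le>o |Y2|" for X1 X2 Y1 Y2
  proof -
    obtain f where f: "inj_on f X1" "\<And>x. x \<in> X1 \<Longrightarrow> f x \<in> Y1"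
      "\<And>x y. x \<in> X1 \<Longrightarrow> y \<in> X1 \<Longrightarrow> (x, y) \<in> r \<longleftrightarrow> (f x, f y) \<in> r"
      using emb by (rule order_embedsE) blast
    obtain h where h': "inj_on h X2 \<and> h ` X2 \<subseteq> Y2" using le by (rule card_of_ordLeqE)
    then have h: "inj_on h X2" "\<And>x. x \<in> X2 \<Longrightarrow> h x \<in> Y2" by auto
    have X: "a \<in> X1 \<and> a \<notin> V \<or> a \<in> X2 \<and> a \<in> V" if "a \<in> X1 \<union> X2" for a
      using that sub disj by blast
    have Y: "f a \<in> C" "f a \<notin> V" if "a \<in> X1" for a using f(2)[OF that] sub disj by blast+
    have Y': "h a \<in> V" "h a \<notin> C" if "a \<in> X2" for a using h(2)[OF that] sub disj by blast+
    define F where "F a = (if a \<in> V then h a else f a)" for a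
    show ?thesis
    proof (rule order_embedsI[of F])
      show "inj_on F (X1 \<union> X2)"
      proof (rule inj_onI)
        fix a b assume ab: "a \<in> X1 \<union> X2" "b \<in> X1 \<union> X2" "F a = F b"
        show "a = b"
          using X[OF ab(1)] X[OF ab(2)] ab(3) inj_onD[OF f(1), of a b] inj_onD[OF h(1), of a b]
            Y[of a] Y[of b] Y'[of a] Y'[of b]
          by (auto simp: F_def)
      qed
      show "F a \<in> Y1 \<union> Y2" if "a \<in> X1 \<union> X2" for a
        using X[OF that] f(2) h(2) by (auto simp: F_def)
      fix a b assume ab: "a \<in> X1 \<union> X2" "b \<in> X1 \<union> X2"
      have eq: "(a, b) \<in> r \<longleftrightarrow> a = b" if "a \<in> V" "b \<in> V" for a b
        using V[OF that] refl that A by blast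
      have hh: "(a, b) \<in> r \<longleftrightarrow> (h a, h b) \<in> r" if "a \<in> X2" "b \<in> X2"
        using eq[of a b] eq[of "h a" "h b"] Y'(1) that sub inj_onD[OF h(1), of a b] by blast
      have fh: "(a, b) \<notin> r" "(f a, h b) \<notin> r" if "a \<in> X1" "b \<in> X2"
        using CV[of b a] CV[of "h b" "f a"] Y(1) Y'(1) that sub by blast+
      have hf: "(a, b) \<in> r" "(h a, f b) \<in> r" if "a \<in> X2" "b \<in> X1"
        using VC[of a b] VC[of "h a" "f b"] Y(1) Y'(1) that sub by blast+
      show "(a, b) \<in> r \<longleftrightarrow> (F a, F b) \<in> r"
        using X[OF ab(1)] X[OF ab(2)] hh fh hf f(3)[of a b] by (auto simp: F_def)
    qed
  qed
  define \<C> where "\<C> = {E. ofilter w1 E} \<union>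
    {E \<union> ?K M | E M. ofilter w0 E \<and> M \<subseteq> V \<and> (\<exists>a\<in>M. \<exists>b\<in>M. a \<noteq> b)}"
  show ?thesis
  proof (rule sub_representable_canonicalI[of _ \<C>])
    fix X assume X: "X \<subseteq> A"
    have X_eq: "(X \<inter> C) \<union> (X \<inter> V) = X" using X A by blast
    show "\<exists>C\<in>\<C>. C \<subseteq> A \<and> order_embeds X r C r \<and> order_embeds C r X r"
    proof (cases "\<exists>a\<in>X \<inter> V. \<exists>b\<in>X \<inter> V. a \<noteq> b")
      case True
      obtain E where E: "ofilter w0 E" "order_embeds (X \<inter> C) w0 E w0" "order_embeds E w0 (X \<inter> C) w0"
        using subset_equimorphic_ofilter[OF w0(1), of "X \<inter> C"] w0(2) by auto
      have EC: "E \<subseteq> C" using E(1) w0(2) by (simp add: ofilter_def)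
      have E': "order_embeds (X \<inter> C) r E r" "order_embeds E r (X \<inter> C) r"
        using E(2,3) EC order_embeds_Restr[of "X \<inter> C" C E r] order_embeds_Restr[of E C "X \<inter> C" r]
        by (simp_all add: w0_def)
      have Ks: "|X \<inter> V| \<le>o |?K (X \<inter> V)|" "|?K (X \<inter> V)| \<le>o |X \<inter> V|" "?K (X \<inter> V) \<subseteq> V"
        using K(2,3)[of "X \<inter> V"] by (simp_all add: ordIso_iff_ordLeq)
      have "order_embeds ((X \<inter> C) \<union> (X \<inter> V)) r (E \<union> ?K (X \<inter> V)) r"
        by (rule emb_sum) (use EC E' Ks in auto)
      moreover have "order_embeds (E \<union> ?K (X \<inter> V)) r ((X \<inter> C) \<union> (X \<inter> V)) r"
        by (rule emb_sum) (use EC E' Ks in auto)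
      moreover have "E \<union> ?K (X \<inter> V) \<in> \<C>"
        unfolding \<C>_def using E(1) True by blast
      ultimately show ?thesis using EC Ks(3) A
        by (intro bexI[of _ "E \<union> ?K (X \<inter> V)"]) (auto simp: X_eq)
    next
      case False
      define v where "v = (if X \<inter> V = {} then {} else {u0})"
      define X' where "X' = (X \<inter> C) \<union> v"
      have vs: "v \<subseteq> V" "v \<subseteq> {u0}" using u0 by (auto simp: v_def)
      have v: "|X \<inter> V| \<le>o |v|" "|v| \<le>o |X \<inter> V|"
      proof -
        have "\<exists>p. X \<inter> V \<subseteq> {p}" using False by blast
        then obtain p where p: "X \<inter> V = {} \<or> X \<inter> V = {p}" by auto
        then have "inj_on (\<lambda>_. u0) (X \<inter> V)" "(\<lambda>_. u0) ` (X \<inter> V) \<subseteq> v"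
          by (elim disjE; simp add: v_def)+
        then show "|X \<inter> V| \<le>o |v|" unfolding card_of_ordLeq[symmetric] by blast
        have "inj_on (\<lambda>_. p) v" "(\<lambda>_. p) ` v \<subseteq> X \<inter> V"
          using p by (auto simp: v_def)
        then show "|v| \<le>o |X \<inter> V|" unfolding card_of_ordLeq[symmetric] by blast
      qed
      have XX': "order_embeds X r X' r"
        using emb_sum[of "X \<inter> C" "X \<inter> C" "X \<inter> V" v] v vs order_embeds_subset[of "X \<inter> C" "X \<inter> C" r]
        by (simp add: X_eq X'_def)
      have X'X: "order_embeds X' r X r"
        using emb_sum[of "X \<inter> C" "X \<inter> C" v "X \<inter> V"] v vs order_embeds_subset[of "X \<inter> C" "X \<inter> C" r]
        by (simp add: X_eq X'_def)
      have X'C: "X' \<subseteq> insert u0 C" using vs by (auto simp: X'_def)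
      obtain E where E: "ofilter w1 E" "order_embeds X' w1 E w1" "order_embeds E w1 X' w1"
        using subset_equimorphic_ofilter[OF w1(1), of X'] w1(2) X'C by auto
      have EC: "E \<subseteq> insert u0 C" using E(1) w1(2) by (simp add: ofilter_def)
      have "order_embeds X' r E r" "order_embeds E r X' r"
        using E(2,3) order_embeds_Restr[OF EC X'C] order_embeds_Restr[OF X'C EC]
        by (simp_all add: w1_def)
      then have "order_embeds X r E r" "order_embeds E r X r"
        using XX' X'X order_embeds_trans by blast+
      moreover have "E \<in> \<C>" using E(1) by (simp add: \<C>_def)
      moreover have "E \<subseteq> A" using EC A u0 by blast
      ultimately show ?thesis by blast
    qed
  next
    have two: "\<exists>a\<in>?K M. \<exists>b\<in>?K M. a \<noteq> b" if M: "M \<subseteq> V" "a \<in> M" "b \<in> M" "a \<noteq> b" for M a b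
    proof -
      have "|M| \<le>o |?K M|" using K(2)[OF M(1)] by (simp add: ordIso_iff_ordLeq)
      then obtain h where h: "inj_on h M \<and> h ` M \<subseteq> ?K M" by (rule card_of_ordLeqE)
      then have "h a \<noteq> h b" using M inj_onD[OF conjunct1[OF h], of a b] by blast
      with h M show ?thesis by blast
    qed
    fix D D' assume D: "D \<in> \<C>" and D': "D' \<in> \<C>" and emb: "order_embeds D r D' r"
    obtain f where f: "inj_on f D" "\<And>a. a \<in> D \<Longrightarrow> f a \<in> D'"
      "\<And>a b. a \<in> D \<Longrightarrow> b \<in> D \<Longrightarrow> (a, b) \<in> r \<longleftrightarrow> (f a, f b) \<in> r"
      using emb by (rule order_embedsE) blast
    have sub1: "E \<subseteq> insert u0 C" if "ofilter w1 E" for E using that w1(2) by (simp add: ofilter_def)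
    have sub0: "E \<subseteq> C" if "ofilter w0 E" for E using that w0(2) by (simp add: ofilter_def)
    consider "ofilter w1 D" "ofilter w1 D'"
      | E M where "ofilter w1 D" "D' = E \<union> ?K M" "ofilter w0 E" "M \<subseteq> V" "\<exists>a\<in>M. \<exists>b\<in>M. a \<noteq> b"
      | E M where "ofilter w1 D'" "D = E \<union> ?K M" "ofilter w0 E" "M \<subseteq> V" "\<exists>a\<in>M. \<exists>b\<in>M. a \<noteq> b"
      | E M E' M' where "D = E \<union> ?K M" "ofilter w0 E" "M \<subseteq> V" "\<exists>a\<in>M. \<exists>b\<in>M. a \<noteq> b"
        "D' = E' \<union> ?K M'" "ofilter w0 E'" "M' \<subseteq> V"
      using D D' unfolding \<C>_def by blast
    then show "D \<subseteq> D'"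
    proof cases
      case 1
      then have "order_embeds D w1 D' w1"
        using emb order_embeds_Restr[OF sub1 sub1] by (simp add: w1_def)
      then show ?thesis using ofilter_embeds_imp_subset[OF w1(1)] 1 by blast
    next
      \<comment> \<open>At most one point of the chain \<open>D\<close> is sent into
        \<open>V\<close>. Redirecting it to \<open>u0\<close> embeds \<open>D\<close> in
        \<open>insert u0 E\<close>, a segment of \<open>w1\<close>, where embeddability gives
        inclusion.\<close>
      case (2 E M)
      have KM: "?K M \<subseteq> V" "E \<subseteq> C" using K(3) 2 sub0 by blast+
      define f' where "f' a = (if f a \<in> V then u0 else f a)" for a
      have cases: "f a \<in> V \<and> f a \<notin> C \<or> f a \<in> E \<and> f a \<in> C \<and> f a \<notin> V" if "a \<in> D" for a
        using f(2)[OF that] 2 KM disj by blast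
      have u0C: "u0 \<notin> C" using u0 disj by blast
      have VV: "a = b" if "a \<in> D" "b \<in> D" "f a \<in> V" "f b \<in> V" for a b
      proof -
        have "(a, b) \<in> r \<or> (b, a) \<in> r" using C1 sub1[OF 2(1)] that by blast
        then have "f a = f b" using f(3) V that by metis
        then show ?thesis using f(1) that by (auto dest: inj_onD)
      qed
      have "order_embeds D r (insert u0 E) r"
      proof (rule order_embedsI[of f'])
        show "inj_on f' D"
        proof (rule inj_onI)
          fix a b assume ab: "a \<in> D" "b \<in> D" "f' a = f' b"
          show "a = b"
            using cases[OF ab(1)] cases[OF ab(2)] ab VV[of a b] inj_onD[OF f(1), of a b] u0C u0(1)
            by (auto simp: f'_def)
        qed
        show "f' a \<in> insert u0 E" if "a \<in> D" for a
          using cases[OF that] by (auto simp: f'_def)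
        fix a b assume ab: "a \<in> D" "b \<in> D"
        have "(u0, u0) \<in> r" using u0 refl A by blast
        moreover have "(a, a) \<in> r" using ab(1) refl sub1[OF 2(1)] A u0 by blast
        ultimately show "(a, b) \<in> r \<longleftrightarrow> (f' a, f' b) \<in> r"
          using cases[OF ab(1)] cases[OF ab(2)] VV[OF ab] f(3)[OF ab]
            VC[of u0 "f b"] VC[of "f a" "f b"] CV[of u0 "f a"] CV[of "f b" "f a"] u0(1)
          by (auto simp: f'_def)
      qed
      then have "order_embeds D w1 (insert u0 E) w1"
        using order_embeds_Restr[OF sub1[OF 2(1)] insert_mono[OF KM(2)]] unfolding w1_def by blast
      moreover have "ofilter w1 (insert u0 E)"
        unfolding ofilter_def under_def
      proof (intro conjI ballI subsetI; clarify?)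
        show "a \<in> Field w1" if "a \<in> insert u0 E" for a using that KM(2) w1(2) by blast
        fix a b assume ab: "a \<in> insert u0 E" "(b, a) \<in> w1" "b \<notin> E"
        then have b: "b \<in> insert u0 C" "(b, a) \<in> r" by (auto simp: w1_def)
        show "b = u0"
        proof (cases "a = u0")
          case True
          then show ?thesis using b CV[of u0 b] u0 by blast
        next
          case False
          then have "a \<in> E" using ab by blast
          then have "b \<notin> C" using ofilterD[OF 2(3), of a b] b ab(3) KM(2) by (auto simp: w0_def)
          then show ?thesis using b by blast
        qed
      qed
      ultimately have "D \<subseteq> insert u0 E" using ofilter_embeds_imp_subset[OF w1(1) 2(1)] by blast
      moreover have "u0 \<in> ?K M"
      proof -
        obtain a where a: "a \<in> ?K M" using two[OF 2(4)] 2(5) by blast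
        then show ?thesis using u0(2)[of a] ofilterD[OF K(1)[OF 2(4)] a] KM by blast
      qed
      ultimately show ?thesis using 2(2) by blast
    next
      \<comment> \<open>Two incomparable points of \<open>?K M\<close> would have to be mapped into
        a chain.\<close>
      case (3 E M)
      obtain a b where ab: "a \<in> ?K M" "b \<in> ?K M" "a \<noteq> b" using two[OF 3(4)] 3(5) by blast
      then have "(a, b) \<notin> r" "(b, a) \<notin> r" using V K(3)[OF 3(4)] by blast+
      moreover have "f a \<in> insert u0 C" "f b \<in> insert u0 C" using f(2) sub1[OF 3(1)] ab 3(2) by blast+
      ultimately have False using C1[of "f a" "f b"] f(3)[of a b] f(3)[of b a] ab 3(2) by blast
      then show ?thesis ..
    next
      \<comment> \<open>Each point of \<open>?K M\<close> has an incomparable partner, so it cannot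
        go into \<open>C\<close>, whose points are comparable to everything. A point of
        \<open>E\<close> lies strictly above \<open>a0\<close>, whose image is in \<open>V\<close>,
        so it cannot go into the antichain. Hence \<open>f\<close> respects both parts.\<close>
      case (4 E M E' M')
      note KM = K(3)[OF 4(3)] K(3)[OF 4(7)] sub0[OF 4(2)] sub0[OF 4(6)]
      obtain a0 b0 where ab: "a0 \<in> ?K M" "b0 \<in> ?K M" "a0 \<noteq> b0" using two[OF 4(3)] 4(4) by blast
      have fV: "f a \<in> ?K M'" if a: "a \<in> ?K M" for a
      proof (rule ccontr)
        assume "f a \<notin> ?K M'"
        then have fa: "f a \<in> C" using f(2)[of a] 4(1,5) KM a by blast
        obtain b where b: "b \<in> ?K M" "b \<noteq> a" using ab by blast
        have "(a, b) \<notin> r" "(b, a) \<notin> r" using V KM(1) a b by blast+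
        then have "(f a, f b) \<notin> r" "(f b, f a) \<notin> r"
          using f(3)[of a b] f(3)[of b a] 4(1) a b by simp_all
        moreover have "f b \<in> C \<or> f b \<in> V" using f(2)[of b] 4(1,5) KM b by blast
        ultimately show False using C[OF fa] VC[OF _ fa] by blast
      qed
      have fC: "f c \<in> E'" if c: "c \<in> E" for c
      proof (rule ccontr)
        assume "f c \<notin> E'"
        then have fc: "f c \<in> V" using f(2)[of c] 4(1,5) KM c by blast
        have "(a0, c) \<in> r" using VC[of a0 c] ab(1) KM c by blast
        then have "(f a0, f c) \<in> r" using f(3)[of a0 c] ab(1) c 4(1) by blast
        then have "f a0 = f c" using V[of "f a0" "f c"] fc fV[OF ab(1)] KM by blast
        then have "a0 = c" using inj_onD[OF f(1), of a0 c] ab(1) c 4(1) by blast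
        then show False using ab(1) c KM disj by blast
      qed
      have "order_embeds E r E' r"
        by (rule order_embedsI[of f]) (use f(1,3) fC 4(1) in \<open>auto intro: inj_on_subset\<close>)
      then have "order_embeds E w0 E' w0"
        using order_embeds_Restr[OF KM(3,4)] by (simp add: w0_def)
      then have "E \<subseteq> E'" using ofilter_embeds_imp_subset[OF w0(1)] 4 by blast
      moreover have "|M| \<le>o |M'|"
      proof -
        have "|M| =o |?K M|" using K(2)[OF 4(3)] by (rule ordIso_symmetric)
        also have "inj_on f (?K M)" using f(1) 4(1) by (auto intro: inj_on_subset)
        then have "|?K M| \<le>o |?K M'|"
          unfolding card_of_ordLeq[symmetric] using fV by blast
        also have "|?K M'| =o |M'|" by (rule K(2)[OF 4(7)])
        finally show ?thesis .
      qed
      then have "?K M \<subseteq> ?K M'" by (rule cardinal_segment_mono)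
      ultimately show ?thesis using 4(1,5) by blast
    qed
  qed
qed

section \<open>Duality\<close>

lemma flower_converse: "flower A (r\<inverse>) \<longleftrightarrow> co_flower A r"
proof -
  have "aboveS (r\<inverse>) x = underS r x" "underS (r\<inverse>) x = aboveS r x" for x
    by (auto simp: aboveS_def underS_def)
  moreover have "antichain_on X (r\<inverse>) \<longleftrightarrow> antichain_on X r" for X
    unfolding antichain_on_def by (metis converse_iff)
  moreover have "well_ordered_star_chain_on X (r\<inverse>) \<longleftrightarrow> well_ordered_chain_on X r" for X
    unfolding well_ordered_star_chain_on_def well_ordered_chain_on_def chain_on_def by auto
  ultimately show ?thesis unfolding flower_def co_flower_def by (simp add: Un_commute)
qed

lemma order_isomorphic_board_converse:
  assumes "order_isomorphic A r (board_carrier B) (board_order B)"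
  shows "order_isomorphic A (r\<inverse>) (board_carrier ((\<lambda>(h, f). (h\<inverse>, f)) ` B))
    (board_order ((\<lambda>(h, f). (h\<inverse>, f)) ` B))"
proof -
  let ?d = "\<lambda>(h :: 'b rel, f :: 'c rel). (h\<inverse>, f)"
  let ?D = "\<lambda>(b, c :: 'c, x :: 'b). (?d b, c, x)"
  obtain \<phi> where \<phi>: "bij_betw \<phi> A (board_carrier B)"
    "\<And>x y. x \<in> A \<Longrightarrow> y \<in> A \<Longrightarrow> (x, y) \<in> r \<longleftrightarrow> (\<phi> x, \<phi> y) \<in> board_order B"
    using assms by (rule order_isomorphicE) blast
  have "bij_betw ?D (board_carrier B) (board_carrier (?d ` B))"
    unfolding bij_betw_def
  proof
    show "inj_on ?D (board_carrier B)" by (auto simp: inj_on_def)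
    show "?D ` board_carrier B = board_carrier (?d ` B)"
      by (force simp: board_carrier_def image_iff)
  qed
  then have "bij_betw (?D \<circ> \<phi>) A (board_carrier (?d ` B))"
    by (rule bij_betw_trans[OF \<phi>(1)])
  moreover have "(x, y) \<in> r\<inverse> \<longleftrightarrow> ((?D \<circ> \<phi>) x, (?D \<circ> \<phi>) y) \<in> board_order (?d ` B)"
    if xy: "x \<in> A" "y \<in> A" for x y
  proof -
    have *: "(q, p) \<in> board_order B \<longleftrightarrow> (?D p, ?D q) \<in> board_order (?d ` B)" for p q
      by (cases p; cases q) (force simp: board_order_def image_iff)
    show ?thesis using \<phi>(2)[OF xy(2,1)] *[of "\<phi> y" "\<phi> x"] by simp
  qed
  ultimately show ?thesis unfolding order_isomorphic_def by blast
qed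

lemma pinboard_poset_converse: "pinboard_poset A (r\<inverse>) \<longleftrightarrow> co_pinboard_poset A r"
proof -
  let ?d = "\<lambda>(h :: 'a rel, f :: 'a rel). (h\<inverse>, f)"
  have dd: "?d ` ?d ` B = B" for B by (force simp: image_iff)
  show ?thesis
  proof
    assume "pinboard_poset A (r\<inverse>)"
    then obtain B :: "('a rel \<times> 'a rel) set" where B: "pinboard B"
      "order_isomorphic A (r\<inverse>) (board_carrier B) (board_order B)"
      unfolding pinboard_poset_def by blast
    have "co_pinboard (?d ` B)" using B(1) by (simp only: co_pinboard_def dd)
    then show "co_pinboard_poset A r"
      using order_isomorphic_board_converse[OF B(2)] unfolding co_pinboard_poset_def converse_converse by blast
  next
    assume "co_pinboard_poset A r"
    then obtain B :: "('a rel \<times> 'a rel) set" where B: "pinboard (?d ` B)"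
      "order_isomorphic A r (board_carrier B) (board_order B)"
      unfolding co_pinboard_poset_def co_pinboard_def by blast
    then show "pinboard_poset A (r\<inverse>)"
      using order_isomorphic_board_converse[OF B(2)] unfolding pinboard_poset_def by blast
  qed
qed

section \<open>Finite chains and ascending sequences\<close>

lemma finite_chain_least:
  assumes "finite Y" "Y \<noteq> {}" "chain_on Y r" "trans r"
  shows "\<exists>m\<in>Y. \<forall>y\<in>Y. (m, y) \<in> r"
  using assms
proof (induction rule: finite_ne_induct)
  case (singleton x)
  then show ?case by (simp add: chain_on_def)
next
  case (insert x F)
  then obtain m where m: "m \<in> F" "\<And>y. y \<in> F \<Longrightarrow> (m, y) \<in> r" by (auto simp: chain_on_def)
  have "(x, x) \<in> r" "(x, m) \<in> r \<or> (m, x) \<in> r" using insert.prems(1) m(1) by (auto simp: chain_on_def)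
  then consider "(m, x) \<in> r" | "(x, m) \<in> r" by blast
  then show ?case
  proof cases
    case 1
    then show ?thesis using m by auto
  next
    case 2
    then have "(x, y) \<in> r" if "y \<in> insert x F" for y
      using that m(2) \<open>(x, x) \<in> r\<close> transD[OF insert.prems(2)] by blast
    then show ?thesis by blast
  qed
qed

lemma chain_on_subset: "chain_on Y r \<Longrightarrow> X \<subseteq> Y \<Longrightarrow> chain_on X r"
  unfolding chain_on_def by blast

lemma chain_on_converse: "chain_on Y (r\<inverse>) \<longleftrightarrow> chain_on Y r"
  unfolding chain_on_def by auto

lemma order_embeds_chain:
  assumes "order_embeds X r Y s" "chain_on Y s"
  shows "chain_on X r"
proof -
  obtain f where f: "inj_on f X" "\<And>x. x \<in> X \<Longrightarrow> f x \<in> Y"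
    "\<And>x y. x \<in> X \<Longrightarrow> y \<in> X \<Longrightarrow> (x, y) \<in> r \<longleftrightarrow> (f x, f y) \<in> s"
    using assms(1) by (rule order_embedsE) blast
  show ?thesis unfolding chain_on_def
  proof (intro ballI)
    fix x y assume "x \<in> X" "y \<in> X"
    then show "(x, y) \<in> r \<or> (y, x) \<in> r"
      using f(2)[of x] f(2)[of y] f(3)[of x y] f(3)[of y x] assms(2) by (simp add: chain_on_def)
  qed
qed

lemma finite_chain_well_ordered:
  assumes "finite X" "chain_on X r" "trans r"
  shows "well_ordered_chain_on X r"
  unfolding well_ordered_chain_on_def
proof (intro conjI allI impI)
  fix Y assume "Y \<subseteq> X" "Y \<noteq> {}"
  then show "\<exists>m\<in>Y. \<forall>y\<in>Y. (m, y) \<in> r"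
    using assms chain_on_subset[OF assms(2), of Y] finite_subset[of Y X] finite_chain_least by blast
qed (rule assms(2))

text \<open>Compare the two as well-orders. If the comparison embeds \<open>Y\<close> in
  \<open>X\<close> instead, the cardinalities make that map onto, and its inverse is the desired
  embedding.\<close>

lemma finite_chain_embeds:
  assumes r: "partial_order_on A r" and X: "X \<subseteq> A" "chain_on X r" "finite X"
    and Y: "Y \<subseteq> A" "chain_on Y r" "finite Y" and card: "card X \<le> card Y"
  shows "order_embeds X r Y r"
proof -
  let ?p = "Restr r X" and ?q = "Restr r Y"
  have trans: "trans r" using r by (simp add: order_on_defs)
  have "well_order_on X ?p" "well_order_on Y ?q"
    using X Y finite_chain_well_ordered[OF _ _ trans]
    by (auto intro!: well_order_on_Restr_if_well_ordered_chain[OF r])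
  then have p: "Well_order ?p" "Field ?p = X" and q: "Well_order ?q" "Field ?q = Y"
    using well_order_on_Well_order by blast+
  from ordLeq_total[OF p(1) q(1)] show ?thesis
  proof
    assume "?p \<le>o ?q"
    then obtain f where f: "inj_on f (Field ?p)" "ofilter ?q (f ` Field ?p)"
      "\<And>x y. x \<in> Field ?p \<Longrightarrow> y \<in> Field ?p \<Longrightarrow> (x, y) \<in> ?p \<longleftrightarrow> (f x, f y) \<in> ?q"
      by (rule ordLeq_ofilter_iso) blast
    have sub: "f x \<in> Y" if "x \<in> X" for x using f(2) that p(2) q(2) by (auto simp: ofilter_def)
    show ?thesis
    proof (rule order_embedsI[of f])
      show "inj_on f X" using f(1) p(2) by simp
      show "f x \<in> Y" if "x \<in> X" for x by (rule sub[OF that])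
      fix x y assume "x \<in> X" "y \<in> X"
      then show "(x, y) \<in> r \<longleftrightarrow> (f x, f y) \<in> r" using f(3)[of x y] sub p(2) by simp
    qed
  next
    assume "?q \<le>o ?p"
    then obtain f where f: "inj_on f (Field ?q)" "ofilter ?p (f ` Field ?q)"
      "\<And>x y. x \<in> Field ?q \<Longrightarrow> y \<in> Field ?q \<Longrightarrow> (x, y) \<in> ?q \<longleftrightarrow> (f x, f y) \<in> ?p"
      by (rule ordLeq_ofilter_iso) blast
    have sub: "f ` Y \<subseteq> X" using f(2) p(2) q(2) by (auto simp: ofilter_def)
    have inj: "inj_on f Y" using f(1) q(2) by simp
    have "f ` Y = X"
      using card_subset_eq[OF X(3) sub] card_image[OF inj] card card_mono[OF X(3) sub] by simp
    moreover have "order_embeds (f ` Y) r Y r"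
    proof (rule order_embeds_image(2)[OF inj])
      fix x y assume xy: "x \<in> Y" "y \<in> Y"
      then have "f x \<in> X" "f y \<in> X" using sub by blast+
      with xy show "(x, y) \<in> r \<longleftrightarrow> (f x, f y) \<in> r" using f(3)[of x y] q(2) by simp
    qed
    ultimately show ?thesis by simp
  qed
qed

text \<open>No infinite chain is required, so disjoint finite chains of growing size qualify. The
  notion is self-dual, which allows ascending and descending sequences to be compared.\<close>

definition unbounded_chains :: "'a set \<Rightarrow> 'a rel \<Rightarrow> bool" where
  "unbounded_chains X r \<longleftrightarrow> (\<forall>n. \<exists>c\<subseteq>X. finite c \<and> card c = n \<and> chain_on c r)"

lemma unbounded_chains_converse: "unbounded_chains X (r\<inverse>) \<longleftrightarrow> unbounded_chains X r"
  by (simp add: unbounded_chains_def chain_on_converse)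

definition ascending :: "(nat \<Rightarrow> 'a) \<Rightarrow> 'a rel \<Rightarrow> bool" where
  "ascending t r \<longleftrightarrow> (\<forall>i j. (t i, t j) \<in> r \<longleftrightarrow> i \<le> j)"

lemma ascending_inj: "ascending t r \<Longrightarrow> inj t"
  unfolding ascending_def inj_on_def by (metis le_antisym order_refl)

lemma ascending_chain:
  assumes t: "ascending t r" and X: "X \<subseteq> range t"
  shows "chain_on X r"
proof -
  have "chain_on (range t) r"
    using t by (auto simp: chain_on_def ascending_def)
  then show ?thesis using X by (rule chain_on_subset)
qed

lemma ascending_unbounded_chains: "ascending t r \<Longrightarrow> unbounded_chains (range t) r"
  unfolding unbounded_chains_def
proof (intro allI)
  fix n assume t: "ascending t r"
  have "card (t ` {..<n}) = n" using card_image[of t "{..<n}"] ascending_inj[OF t] by (simp add: inj_on_def)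
  then show "\<exists>c\<subseteq>range t. finite c \<and> card c = n \<and> chain_on c r"
    using ascending_chain[OF t, of "t ` {..<n}"] by (intro exI[of _ "t ` {..<n}"]) auto
qed

text \<open>If \<open>a\<close> is sent to \<open>t k\<close>, everything in \<open>G\<close> below
  \<open>a\<close> is sent to \<open>t 0\<close>, ..., \<open>t k\<close>.\<close>

lemma embeds_ascending_finite_below:
  assumes t: "ascending t r" and emb: "order_embeds G s (range t) r" and a: "a \<in> G"
  shows "finite {b \<in> G. (b, a) \<in> s}"
proof -
  obtain f where f: "inj_on f G" "\<And>x. x \<in> G \<Longrightarrow> f x \<in> range t"
    "\<And>x y. x \<in> G \<Longrightarrow> y \<in> G \<Longrightarrow> (x, y) \<in> s \<longleftrightarrow> (f x, f y) \<in> r"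
    using emb by (rule order_embedsE) blast
  obtain k where k: "f a = t k" using f(2)[OF a] by blast
  have "f b \<in> t ` {..k}" if b: "b \<in> G" "(b, a) \<in> s" for b
  proof -
    obtain i where i: "f b = t i" using f(2)[OF b(1)] by blast
    then have "i \<le> k" using f(3)[OF b(1) a] b(2) k t by (simp add: ascending_def)
    then show ?thesis using i by simp
  qed
  then have "f ` {b \<in> G. (b, a) \<in> s} \<subseteq> t ` {..k}" by blast
  then have "finite (f ` {b \<in> G. (b, a) \<in> s})" by (rule finite_subset) simp
  moreover have "inj_on f {b \<in> G. (b, a) \<in> s}" using f(1) by (rule inj_on_subset) blast
  ultimately show ?thesis by (rule finite_imageD)
qed

lemma ex_ascending:
  assumes r: "partial_order_on A r" and Y: "Y \<subseteq> A" "Y \<noteq> {}" "chain_on Y r"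
    and no: "\<not> (\<exists>m\<in>Y. \<forall>y\<in>Y. (y, m) \<in> r)"
  shows "\<exists>t. ascending t r \<and> range t \<subseteq> Y"
proof -
  have trans: "trans r" and refl: "refl_on A r" and anti: "antisym r"
    using r by (simp_all add: order_on_defs)
  have "\<exists>z\<in>Y. (y, z) \<in> r \<and> z \<noteq> y" if "y \<in> Y" for y
    using no that Y unfolding chain_on_def by metis
  then obtain nx where nx: "\<And>y. y \<in> Y \<Longrightarrow> nx y \<in> Y \<and> (y, nx y) \<in> r \<and> nx y \<noteq> y" by metis
  obtain y0 where y0: "y0 \<in> Y" using Y(2) by blast
  define t where "t i = (nx ^^ i) y0" for i
  have tY: "t i \<in> Y" for i by (induction i) (use y0 nx in \<open>auto simp: t_def\<close>)
  have step: "(t i, t (Suc i)) \<in> r \<and> t (Suc i) \<noteq> t i" for i using nx[OF tY[of i]] by (simp add: t_def)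
  have refl': "(t i, t i) \<in> r" for i using refl tY Y(1) by (auto simp: refl_on_def)
  have le: "(t i, t j) \<in> r" if "i \<le> j" for i j
    using that
  proof (induction rule: dec_induct)
    case (step j)
    then show ?case using transD[OF trans] \<open>\<And>i. (t i, t (Suc i)) \<in> r \<and> t (Suc i) \<noteq> t i\<close> by blast
  qed (rule refl')
  have "i \<le> j" if "(t i, t j) \<in> r" for i j
  proof (rule ccontr)
    assume "\<not> i \<le> j"
    then have "(t (Suc j), t i) \<in> r" by (intro le) simp
    then have "(t (Suc j), t j) \<in> r" using that transD[OF trans] by blast
    then show False using step[of j] antisymD[OF anti] by blast
  qed
  with le have "ascending t r" unfolding ascending_def by blast
  with tY show ?thesis by blast
qed

section \<open>Sub-representable posets\<close>

locale represented_poset =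
  fixes A :: "'a set" and r :: "'a rel" and g :: "'a set \<Rightarrow> 'a set"
  assumes po: "partial_order_on A r"
    and g_sub: "\<And>X. X \<subseteq> A \<Longrightarrow> g X \<subseteq> A"
    and g_mono: "\<And>X Y. X \<subseteq> A \<Longrightarrow> Y \<subseteq> A \<Longrightarrow> order_embeds X r Y r \<Longrightarrow> g X \<subseteq> g Y"
    and to_g: "\<And>X. X \<subseteq> A \<Longrightarrow> order_embeds X r (g X) r"
    and from_g: "\<And>X. X \<subseteq> A \<Longrightarrow> order_embeds (g X) r X r"
begin

lemma refl: "a \<in> A \<Longrightarrow> (a, a) \<in> r"
  using po by (simp add: order_on_defs refl_on_def)

lemma trans: "(a, b) \<in> r \<Longrightarrow> (b, c) \<in> r \<Longrightarrow> (a, c) \<in> r"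
  using po by (auto simp: order_on_defs dest: transD)

lemma anti: "(a, b) \<in> r \<Longrightarrow> (b, a) \<in> r \<Longrightarrow> a = b"
  using po by (auto simp: order_on_defs dest: antisymD)

lemma rel_carrier: "(a, b) \<in> r \<Longrightarrow> a \<in> A \<and> b \<in> A"
  using po by (auto simp: order_on_defs)

text \<open>The same \<open>g\<close> represents the dual order, so every result about the locale
  can be dualised.\<close>

lemma represented_converse: "represented_poset A (r\<inverse>) g"
  by unfold_locales (use po g_sub g_mono to_g from_g in
    \<open>simp_all add: order_embeds_converse partial_order_on_converse\<close>)

lemma g_finite:
  assumes X: "X \<subseteq> A" "finite X"
  shows "finite (g X)" "card (g X) = card X"
proof -
  show fin: "finite (g X)" by (rule order_embeds_finite(1)[OF from_g[OF X(1)] X(2)])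
  show "card (g X) = card X"
    using order_embeds_finite(2)[OF from_g[OF X(1)] X(2)] order_embeds_finite(2)[OF to_g[OF X(1)] fin]
    by simp
qed

lemma g_chain: "X \<subseteq> A \<Longrightarrow> chain_on X r \<Longrightarrow> chain_on (g X) r"
  by (rule order_embeds_chain[OF from_g])

text \<open>Chains of equal finite size embed in each other, so the image of an
  \<open>n\<close>-chain does not depend on where it was taken. The union \<open>G\<close> of these
  images is therefore contained in both \<open>g X\<close> and \<open>g Y\<close>, and is infinite
  as it contains sets of every finite size.\<close>

lemma common_chain:
  assumes X: "X \<subseteq> A" "unbounded_chains X r" and Y: "Y \<subseteq> A" "unbounded_chains Y r"
  shows "\<exists>G. infinite G \<and> chain_on G r \<and> order_embeds G r X r \<and> order_embeds G r Y r"
proof -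
  obtain c where c: "\<And>n. c n \<subseteq> X \<and> finite (c n) \<and> card (c n) = n \<and> chain_on (c n) r"
    using X(2) unfolding unbounded_chains_def by metis
  obtain d where d: "\<And>n. d n \<subseteq> Y \<and> finite (d n) \<and> card (d n) = n \<and> chain_on (d n) r"
    using Y(2) unfolding unbounded_chains_def by metis
  have cA: "c n \<subseteq> A" and dA: "d n \<subseteq> A" for n using c d X(1) Y(1) by blast+
  define G where "G = (\<Union>n. g (c n))"
  have mono: "g (c m) \<subseteq> g (c n)" if "m \<le> n" for m n
    using c that by (intro g_mono cA finite_chain_embeds[OF po]) auto
  have GX: "G \<subseteq> g X"
    unfolding G_def using g_mono[OF cA X(1)] c order_embeds_subset by (metis UN_least)
  have GY: "G \<subseteq> g Y"
    unfolding G_def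
  proof (rule UN_least)
    fix n
    have "g (c n) \<subseteq> g (d n)" using c d by (intro g_mono cA dA finite_chain_embeds[OF po]) auto
    also have "\<dots> \<subseteq> g Y" using d by (intro g_mono dA Y(1) order_embeds_subset) auto
    finally show "g (c n) \<subseteq> g Y" .
  qed
  have "chain_on G r"
    unfolding chain_on_def
  proof (intro ballI)
    fix x y assume "x \<in> G" "y \<in> G"
    then obtain m n where "x \<in> g (c m)" "y \<in> g (c n)" by (auto simp: G_def)
    then have "x \<in> g (c (max m n))" "y \<in> g (c (max m n))"
      using mono[of m "max m n"] mono[of n "max m n"] by auto
    moreover have "chain_on (g (c (max m n))) r" using c by (intro g_chain cA) auto
    ultimately show "(x, y) \<in> r \<or> (y, x) \<in> r" by (simp add: chain_on_def)
  qed
  moreover have "infinite G"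
  proof
    assume fin: "finite G"
    have "g (c (Suc (card G))) \<subseteq> G" by (auto simp: G_def)
    from card_mono[OF fin this] show False using g_finite(2)[OF cA] c by simp
  qed
  moreover have "order_embeds G r X r" "order_embeds G r Y r"
    using order_embeds_trans[OF order_embeds_subset[OF GX] from_g[OF X(1)]]
      order_embeds_trans[OF order_embeds_subset[OF GY] from_g[OF Y(1)]] .
  ultimately show ?thesis by blast
qed

text \<open>Failure of both sides gives an ascending and a descending sequence. An infinite chain
  embedding in both would have finitely many elements below, and finitely many above, any given
  one.\<close>

lemma greatest_or_least:
  "(\<forall>Y\<subseteq>A. Y \<noteq> {} \<and> chain_on Y r \<longrightarrow> (\<exists>m\<in>Y. \<forall>y\<in>Y. (y, m) \<in> r)) \<or>
   (\<forall>Y\<subseteq>A. Y \<noteq> {} \<and> chain_on Y r \<longrightarrow> (\<exists>m\<in>Y. \<forall>y\<in>Y. (m, y) \<in> r))"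
proof (rule ccontr)
  assume n: "\<not> ?thesis"
  obtain Y where Y: "Y \<subseteq> A" "Y \<noteq> {}" "chain_on Y r" "\<not> (\<exists>m\<in>Y. \<forall>y\<in>Y. (y, m) \<in> r)"
    using n by blast
  obtain Z where Z: "Z \<subseteq> A" "Z \<noteq> {}" "chain_on Z r" "\<not> (\<exists>m\<in>Z. \<forall>y\<in>Z. (m, y) \<in> r)"
    using n by blast
  obtain t where t: "ascending t r" "range t \<subseteq> Y" using ex_ascending[OF po Y] by blast
  have "\<exists>t. ascending t (r\<inverse>) \<and> range t \<subseteq> Z"
    by (rule ex_ascending[of A]) (use po Z in \<open>simp_all add: chain_on_converse partial_order_on_converse\<close>)
  then obtain u where u: "ascending u (r\<inverse>)" "range u \<subseteq> Z" by blast
  have tA: "range t \<subseteq> A" "range u \<subseteq> A" using t(2) u(2) Y(1) Z(1) by blast+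
  obtain G where G: "infinite G" "chain_on G r" "order_embeds G r (range t) r" "order_embeds G r (range u) r"
    using common_chain[OF tA(1) ascending_unbounded_chains[OF t(1)] tA(2)]
      ascending_unbounded_chains[OF u(1)] unbounded_chains_converse by blast
  obtain a where a: "a \<in> G" using G(1) by (metis finite.emptyI ex_in_conv)
  have "finite {b \<in> G. (b, a) \<in> r}" by (rule embeds_ascending_finite_below[OF t(1) G(3) a])
  moreover have "finite {b \<in> G. (b, a) \<in> r\<inverse>}"
    by (rule embeds_ascending_finite_below[OF u(1) _ a]) (simp add: order_embeds_converse G(4))
  moreover have "G \<subseteq> {b \<in> G. (b, a) \<in> r} \<union> {b \<in> G. (b, a) \<in> r\<inverse>}"
    using G(2) a by (auto simp: chain_on_def)
  ultimately show False using G(1) by (meson finite_UnI finite_subset)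
qed

section \<open>Three-element subsets and the flower case\<close>

lemma mixed_triples_embed:
  assumes Z: "Z \<subseteq> A" "card Z = 3" "a \<in> Z" "b \<in> Z" "a \<noteq> b" "(a, b) \<in> r"
      "c \<in> Z" "d \<in> Z" "(c, d) \<notin> r" "(d, c) \<notin> r"
    and Z': "Z' \<subseteq> A" "card Z' = 3" "a' \<in> Z'" "b' \<in> Z'" "a' \<noteq> b'" "(a', b') \<in> r"
      "c' \<in> Z'" "d' \<in> Z'" "(c', d') \<notin> r" "(d', c') \<notin> r"
  shows "order_embeds Z r Z' r"
proof -
  have eq: "g Z = g {a, b} \<union> g {c, d}"
    if Z: "Z \<subseteq> A" "card Z = 3" "a \<in> Z" "b \<in> Z" "a \<noteq> b" "(a, b) \<in> r"
      "c \<in> Z" "d \<in> Z" "(c, d) \<notin> r" "(d, c) \<notin> r" for Z a b c d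
  proof -
    have sub: "{a, b} \<subseteq> A" "{c, d} \<subseteq> A" using Z by blast+
    have "c \<noteq> d" using refl[of c] Z by blast
    have fin: "finite Z" using Z(2) card.infinite by fastforce
    have card: "card (g {a, b}) = 2" "card (g {c, d}) = 2" "card (g Z) = 3"
      "finite (g {a, b})" "finite (g {c, d})" "finite (g Z)"
      using g_finite[OF sub(1)] g_finite[OF sub(2)] g_finite[OF Z(1) fin] Z(2,5) \<open>c \<noteq> d\<close> by simp_all
    have inc: "g {a, b} \<union> g {c, d} \<subseteq> g Z"
      using Z by (intro Un_least g_mono sub Z(1) order_embeds_subset) auto
    \<comment> \<open>Two different two-element sets inside the three-element set \<open>g Z\<close>
      must cover it, so it is enough that one is a chain and the other is not.\<close>
    have "g {a, b} \<noteq> g {c, d}"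
    proof
      assume eq: "g {a, b} = g {c, d}"
      have "chain_on {a, b} r" using Z(6) refl sub by (auto simp: chain_on_def)
      then have "chain_on (g {c, d}) r" using g_chain[OF sub(1)] eq by simp
      then have "chain_on {c, d} r" by (rule order_embeds_chain[OF to_g[OF sub(2)]])
      then show False using Z by (simp add: chain_on_def)
    qed
    then have "card (g {a, b} \<union> g {c, d}) \<noteq> 2"
      using card card_subset_eq[of "g {a, b} \<union> g {c, d}" "g {a, b}"]
        card_subset_eq[of "g {a, b} \<union> g {c, d}" "g {c, d}"] by auto
    moreover have "card (g {a, b} \<union> g {c, d}) \<ge> 2"
      using card card_mono[of "g {a, b} \<union> g {c, d}" "g {a, b}"] by auto
    moreover have "card (g {a, b} \<union> g {c, d}) \<le> 3"
      using card card_mono[OF _ inc] by simp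
    ultimately have "card (g {a, b} \<union> g {c, d}) = card (g Z)" using card by linarith
    then show ?thesis using card_subset_eq[OF card(6) inc] by simp
  qed
  have pair: "order_embeds {a, b} r {a', b'} r"
    if "a \<in> A" "b \<in> A" "a' \<in> A" "b' \<in> A" "a \<noteq> b" "a' \<noteq> b'"
      "(a, b) \<in> r \<longleftrightarrow> (a', b') \<in> r" "(b, a) \<in> r \<longleftrightarrow> (b', a') \<in> r" for a b a' b'
    by (rule order_embedsI[of "\<lambda>x. if x = a then a' else b'"])
      (use that refl in \<open>auto simp: inj_on_def split: if_splits\<close>)
  have in_A: "a \<in> A" "b \<in> A" "c \<in> A" "d \<in> A" "a' \<in> A" "b' \<in> A" "c' \<in> A" "d' \<in> A"
    using Z Z' by blast+
  have ne: "c \<noteq> d" "c' \<noteq> d'" using refl in_A Z(9) Z'(9) by blast+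
  have "g {a, b} = g {a', b'}"
    by (intro equalityI g_mono pair) (use in_A Z(5,6) Z'(5,6) anti in auto)
  moreover have "g {c, d} = g {c', d'}"
    by (intro equalityI g_mono pair) (use in_A ne Z(9,10) Z'(9,10) in auto)
  ultimately have "g Z = g Z'" using eq[OF Z] eq[OF Z'] by simp
  then have "order_embeds (g Z) r Z' r" using from_g[OF Z'(1)] by simp
  with to_g[OF Z(1)] show ?thesis by (rule order_embeds_trans)
qed

text \<open>\<open>U\<close> collects the points with an incomparable partner and becomes the
  antichain; the points of \<open>C\<close> are comparable to everything and form the chain below
  it. The greatest element of \<open>C\<close> is the centre of the flower.\<close>

lemma flower_if_V:
  assumes V: "(x, y) \<in> r" "(x, z) \<in> r" "(y, z) \<notin> r" "(z, y) \<notin> r"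
  shows "flower A r"
proof -
  have xyz: "x \<in> A" "y \<in> A" "z \<in> A" using V rel_carrier by blast+
  have ne: "x \<noteq> y" "x \<noteq> z" "y \<noteq> z" using V refl xyz by blast+
  \<comment> \<open>The triple \<open>{x, y, z}\<close> embeds in \<open>{a, b, c}\<close>. The
    image of \<open>x\<close> is comparable to both other points, so it can be neither
    \<open>a\<close> nor \<open>b\<close>; it is \<open>c\<close>, which therefore lies below
    both.\<close>
  have V3: "(c, a) \<in> r \<and> (c, b) \<in> r"
    if abc: "a \<in> A" "b \<in> A" "c \<in> A" "(a, b) \<notin> r" "(b, a) \<notin> r" "c \<noteq> a" "(c, a) \<in> r \<or> (a, c) \<in> r" for a b c
  proof -
    have ne': "a \<noteq> b" "c \<noteq> b" using abc refl by blast+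
    have "order_embeds {x, y, z} r {a, b, c} r"
    proof -
      have *: "{x, y, z} \<subseteq> A" "card {x, y, z} = 3" "{a, b, c} \<subseteq> A" "card {a, b, c} = 3"
        using xyz ne abc ne' by auto
      show ?thesis
        using abc(7)
      proof
        assume "(c, a) \<in> r"
        then show ?thesis
          by (intro mixed_triples_embed[OF *(1,2) _ _ ne(1) V(1) _ _ V(3,4) *(3,4) _ _ _ _ _ _ abc(4,5)])
            (use abc in auto)
      next
        assume "(a, c) \<in> r"
        then show ?thesis
          by (intro mixed_triples_embed[OF *(1,2) _ _ ne(1) V(1) _ _ V(3,4) *(3,4), of a c a b])
            (use abc in auto)
      qed
    qed
    then obtain f where f: "inj_on f {x, y, z}" "\<And>u. u \<in> {x, y, z} \<Longrightarrow> f u \<in> {a, b, c}"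
      "\<And>u v. u \<in> {x, y, z} \<Longrightarrow> v \<in> {x, y, z} \<Longrightarrow> (u, v) \<in> r \<longleftrightarrow> (f u, f v) \<in> r"
      by (rule order_embedsE) blast
    have "(f x, f y) \<in> r" "(f x, f z) \<in> r" "(f y, f z) \<notin> r" "(f z, f y) \<notin> r"
      using f(3)[of x y] f(3)[of x z] f(3)[of y z] f(3)[of z y] V by simp_all
    moreover have "f x \<in> {a, b, c}" "f y \<in> {a, b, c}" "f z \<in> {a, b, c}" using f(2) by blast+
    moreover have "f x \<noteq> f y" "f x \<noteq> f z" "f y \<noteq> f z" using inj_onD[OF f(1)] ne by blast+
    ultimately show ?thesis using abc(4,5) by auto
  qed
  define U where "U = {u \<in> A. \<exists>v\<in>A. (u, v) \<notin> r \<and> (v, u) \<notin> r}"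
  define C where "C = A - U"
  have U_anti: "u = u'" if u: "u \<in> U" "u' \<in> U" "(u, u') \<in> r" for u u'
  proof (rule ccontr)
    assume ne: "u \<noteq> u'"
    obtain v where "v \<in> A" "(u, v) \<notin> r" "(v, u) \<notin> r" using u(1) by (auto simp: U_def)
    then have "(u', u) \<in> r" using V3[of u v u'] u ne by (auto simp: U_def)
    then show False using anti u(3) ne by blast
  qed
  have C_comp: "(c, a) \<in> r \<or> (a, c) \<in> r" if "c \<in> C" "a \<in> A" for c a
    using that by (auto simp: C_def U_def)
  have C_below: "(c, u) \<in> r" if c: "c \<in> C" and u: "u \<in> U" for c u
  proof -
    obtain v where v: "v \<in> A" "(u, v) \<notin> r" "(v, u) \<notin> r" using u by (auto simp: U_def)
    have "u \<in> A" "c \<in> A" "c \<noteq> u" using c u by (auto simp: C_def U_def)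
    then show ?thesis using V3[of u v c] C_comp[OF c] v by blast
  qed
  have C_chain: "chain_on C r" using C_comp by (auto simp: chain_on_def C_def)
  have yzU: "y \<in> U" "z \<in> U" using V xyz by (auto simp: U_def)
  have xC: "x \<in> C" using U_anti[of x y] V(1) xyz(1) yzU(1) ne by (auto simp: C_def)
  have CA: "C \<subseteq> A" by (auto simp: C_def)
  have greatest: "\<exists>m\<in>Y. \<forall>y\<in>Y. (y, m) \<in> r" if Y: "Y \<subseteq> C" "Y \<noteq> {}" for Y
  proof (rule ccontr)
    assume no: "\<not> ?thesis"
    have "Y \<subseteq> A" using Y CA by blast
    then obtain t where t: "ascending t r" "range t \<subseteq> Y"
      using ex_ascending[OF po _ Y(2) chain_on_subset[OF C_chain Y(1)] no] by blast
    have tC: "t i \<in> C" for i using t(2) Y(1) by blast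
    have SA: "range t \<subseteq> A" using tC CA by blast
    have tA: "t ` {..<n} \<subseteq> A" for n using SA by blast
    have yzA: "{y, z} \<subseteq> A" using xyz by blast
    have "card (g {x}) = 1" using g_finite(2)[of "{x}"] xyz(1) by simp
    then obtain p where p: "g {x} = {p}" by (auto simp: card_1_singleton_iff)
    have single: "g {x} \<subseteq> g X" if X: "X \<subseteq> A" "X \<noteq> {}" for X
    proof -
      obtain a where a: "a \<in> X" using X(2) by blast
      have "order_embeds {x} r X r"
        by (rule order_embedsI[of "\<lambda>_. a"]) (use a X(1) xyz(1) refl in auto)
      then show ?thesis using xyz(1) X(1) by (intro g_mono) auto
    qed
    have pW: "p \<in> g {y, z}" using single[OF yzA] p by simp
    have "\<not> chain_on (g {y, z}) r"
    proof
      assume "chain_on (g {y, z}) r"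
      then have "chain_on {y, z} r" by (rule order_embeds_chain[OF to_g[OF yzA]])
      then show False using V by (simp add: chain_on_def)
    qed
    moreover have "card (g {y, z}) = 2" using g_finite(2)[OF yzA] ne by simp
    \<comment> \<open>The image \<open>{p}\<close> of a singleton is contained in every image of a
      non-empty set, so \<open>p\<close> is one of the two points of \<open>g {y, z}\<close>, and
      \<open>q\<close> is the other.\<close>
    ultimately obtain q where q: "q \<in> g {y, z}" "(p, q) \<notin> r" "(q, p) \<notin> r"
    proof -
      assume *: "\<And>q. q \<in> g {y, z} \<Longrightarrow> (p, q) \<notin> r \<Longrightarrow> (q, p) \<notin> r \<Longrightarrow> thesis"
        "\<not> chain_on (g {y, z}) r" "card (g {y, z}) = 2"
      obtain a b where "g {y, z} = {a, b}" using *(3) by (auto simp: card_2_iff)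
      with pW have "g {y, z} = {p, a} \<or> g {y, z} = {p, b}" by auto
      then obtain q where q: "g {y, z} = {p, q}" by blast
      have "p \<in> A" "q \<in> A" using q g_sub[OF yzA] by auto
      then have "(p, q) \<notin> r \<and> (q, p) \<notin> r" using *(2) q refl by (auto simp: chain_on_def)
      then show thesis using *(1) q by blast
    qed
    \<comment> \<open>Inside \<open>g ?Z\<close> the point \<open>p\<close> has the incomparable
      partner \<open>q\<close>, so \<open>h\<close> sends \<open>p\<close> into \<open>U\<close>,
      whose points are maximal. An element \<open>e\<close> of the chain image lying above
      \<open>p\<close> would thus have the same value under \<open>h\<close>.\<close>
    have below_p: "(e, p) \<in> r" if e: "e \<in> g (t ` {..<n})" and n: "n > 0" for e n
    proof -
      let ?Z = "t ` {..<n} \<union> {y, z}"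
      have ZA: "?Z \<subseteq> A" using tA yzA by blast
      have sub: "g {y, z} \<subseteq> g ?Z" "g (t ` {..<n}) \<subseteq> g ?Z"
        by (intro g_mono yzA tA ZA order_embeds_subset; blast)+
      have pS: "p \<in> g (t ` {..<n})" using single[OF tA] p n by auto
      obtain h where h: "inj_on h (g ?Z)" "\<And>u. u \<in> g ?Z \<Longrightarrow> h u \<in> ?Z"
        "\<And>u v. u \<in> g ?Z \<Longrightarrow> v \<in> g ?Z \<Longrightarrow> (u, v) \<in> r \<longleftrightarrow> (h u, h v) \<in> r"
        using from_g[OF ZA] by (rule order_embedsE) blast
      have in_Z: "p \<in> g ?Z" "q \<in> g ?Z" "e \<in> g ?Z" using pW q(1) sub e by blast+
      have "(h p, h q) \<notin> r" "(h q, h p) \<notin> r" using h(3) in_Z q by blast+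
      moreover have "h p \<in> A" "h q \<in> A" using h(2) in_Z ZA by blast+
      ultimately have hp: "h p \<in> U" by (auto simp: U_def)
      have "chain_on (g (t ` {..<n})) r" by (rule g_chain[OF tA ascending_chain[OF t(1)]]) blast
      then consider "(e, p) \<in> r" | "(p, e) \<in> r" using e pS by (auto simp: chain_on_def)
      then show ?thesis
      proof cases
        case 2
        then have 3: "(h p, h e) \<in> r" using h(3) in_Z by blast
        have "h e \<in> ?Z" using h(2) in_Z by blast
        then have "h e \<in> C \<or> h e \<in> U" using tC yzU by auto
        then have "h e = h p" using 3 C_below[OF _ hp] U_anti[OF hp] anti by metis
        then have "e = p" using inj_onD[OF h(1)] in_Z by blast
        then show ?thesis using 2 by simp
      qed
    qed
    have pS: "p \<in> g (range t)" using single[OF SA] p by auto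
    have fin: "finite {b \<in> g (range t). (b, p) \<in> r}"
      by (rule embeds_ascending_finite_below[OF t(1) from_g[OF SA] pS])
    \<comment> \<open>One more than the number of points of \<open>g (range t)\<close> below
      \<open>p\<close>, so that the image of an \<open>n\<close>-chain no longer fits there.\<close>
    define n where "n = Suc (card {b \<in> g (range t). (b, p) \<in> r})"
    have sub: "t ` {..<n} \<subseteq> range t" by blast
    have "g (t ` {..<n}) \<subseteq> g (range t)"
      by (rule g_mono[OF tA SA order_embeds_subset[OF sub]])
    moreover have "n > 0" by (simp add: n_def)
    ultimately have "g (t ` {..<n}) \<subseteq> {b \<in> g (range t). (b, p) \<in> r}"
      using below_p[of _ n] by blast
    from card_mono[OF fin this] have "card (g (t ` {..<n})) < n" by (simp add: n_def)
    moreover have "card (t ` {..<n}) = n"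
      using card_image[of t "{..<n}"] ascending_inj[OF t(1)] by (simp add: inj_on_def)
    ultimately show False using g_finite(2)[OF tA[of n]] by simp
  qed
  obtain m where m: "m \<in> C" "\<And>c. c \<in> C \<Longrightarrow> (c, m) \<in> r" using greatest[of C] xC by blast
  have AU: "A = C \<union> U" by (auto simp: C_def U_def)
  have mU: "m \<notin> U" using m(1) by (simp add: C_def)
  have under: "underS r m = C - {m}"
  proof
    show "C - {m} \<subseteq> underS r m" using m(2) by (auto simp: underS_def)
    show "underS r m \<subseteq> C - {m}"
    proof
      fix a assume a: "a \<in> underS r m"
      then have "a \<in> A" "(a, m) \<in> r" "a \<noteq> m" using rel_carrier by (auto simp: underS_def)
      moreover have "a \<notin> U"
      proof
        assume "a \<in> U"
        then have "(m, a) \<in> r" by (rule C_below[OF m(1)])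
        then show False using anti[OF _ \<open>(a, m) \<in> r\<close>] \<open>a \<noteq> m\<close> by blast
      qed
      ultimately show "a \<in> C - {m}" by (simp add: C_def)
    qed
  qed
  have above: "aboveS r m = U"
  proof
    show "U \<subseteq> aboveS r m" using C_below[OF m(1)] mU by (auto simp: aboveS_def)
    show "aboveS r m \<subseteq> U"
    proof
      fix a assume "a \<in> aboveS r m"
      then have a: "a \<in> A" "(m, a) \<in> r" "a \<noteq> m" using rel_carrier by (auto simp: aboveS_def)
      have "a \<notin> C" using m(2)[of a] anti[OF a(2)] a(3) by blast
      then show "a \<in> U" using a(1) AU by blast
    qed
  qed
  show ?thesis
    unfolding flower_def
  proof (rule bexI[of _ m], intro conjI)
    show "well_ordered_star_chain_on (underS r m) r"
      unfolding well_ordered_star_chain_on_def under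
    proof (intro conjI allI impI)
      show "chain_on (C - {m}) r" by (rule chain_on_subset[OF C_chain]) blast
      fix Y assume "Y \<subseteq> C - {m}" "Y \<noteq> {}"
      then show "\<exists>m\<in>Y. \<forall>y\<in>Y. (y, m) \<in> r" by (intro greatest) auto
    qed
    show "antichain_on (aboveS r m) r" unfolding above antichain_on_def using U_anti by blast
    show "\<exists>u\<in>aboveS r m. \<exists>v\<in>aboveS r m. u \<noteq> v" unfolding above using yzU ne by blast
    show "underS r m \<union> aboveS r m \<union> {m} = A" unfolding under above using AU m(1) by blast
    show "m \<in> A" using m(1) CA by blast
  qed
qed

end

section \<open>Disjoint unions of chains as pinboards\<close>

lemma finite_well_orders_ordIso:
  assumes p: "Well_order p" "finite (Field p)" and q: "Well_order q" "finite (Field q)"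
    and card: "card (Field p) = card (Field q)"
  shows "p =o q"
proof -
  obtain f where f: "bij_betw f (Field p) (Field q)"
    using finite_same_card_bij[OF p(2) q(2) card] by blast
  then have inj: "inj_on f (Field p)" and im: "f ` Field p = Field q" by (simp_all add: bij_betw_def)
  have "p =o dir_image p f" by (rule dir_image_ordIso[OF p(1) inj])
  also have "dir_image p f =o q"
  proof (rule finite_well_order_on_ordIso[OF q(2)])
    show "well_order_on (Field q) (dir_image p f)"
      using Well_order_dir_image[OF p(1) inj] by (simp add: dir_image_Field im)
  qed (rule q(1))
  finally show ?thesis .
qed

lemma ordIsoE:
  assumes "p =o q"
  obtains f where "bij_betw f (Field p) (Field q) \<and>
    (\<forall>x\<in>Field p. \<forall>y\<in>Field p. (x, y) \<in> p \<longleftrightarrow> (f x, f y) \<in> q)"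
  using assms unfolding ordIso_def iso_iff2 by blast

locale chain_sum = represented_poset +
  assumes no_V: "\<And>x y z. (x, y) \<in> r \<Longrightarrow> (x, z) \<in> r \<Longrightarrow> (y, z) \<in> r \<or> (z, y) \<in> r"
    and no_Lambda: "\<And>x y z. (y, x) \<in> r \<Longrightarrow> (z, x) \<in> r \<Longrightarrow> (y, z) \<in> r \<or> (z, y) \<in> r"
    and least: "\<And>Y. Y \<subseteq> A \<Longrightarrow> Y \<noteq> {} \<Longrightarrow> chain_on Y r \<Longrightarrow> \<exists>m\<in>Y. \<forall>y\<in>Y. (m, y) \<in> r"
begin

definition cls :: "'a \<Rightarrow> 'a set" where
  "cls x = {y. (x, y) \<in> r \<or> (y, x) \<in> r}"

lemma cls_carrier: "cls x \<subseteq> A"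
  using rel_carrier by (auto simp: cls_def)

lemma in_cls: "x \<in> A \<Longrightarrow> x \<in> cls x"
  using refl by (simp add: cls_def)

lemma cls_eq: "y \<in> cls x \<Longrightarrow> cls y = cls x"
proof -
  have "cls x \<subseteq> cls y" if "y \<in> cls x" for x y
    using that trans no_V no_Lambda unfolding cls_def by blast
  moreover have "x \<in> cls y" if "y \<in> cls x" for x y using that by (auto simp: cls_def)
  ultimately show "y \<in> cls x \<Longrightarrow> cls y = cls x" by blast
qed

lemma cls_chain: "chain_on (cls x) r"
  unfolding chain_on_def using cls_eq by (auto simp: cls_def)

text \<open>The choice depends on \<open>x\<close> only through \<open>cls x\<close>, so points of
  one class get the same root.\<close>

definition root :: "'a \<Rightarrow> 'a" where
  "root x = (SOME m. m \<in> cls x \<and> (\<forall>y\<in>cls x. (m, y) \<in> r))"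

lemma root:
  assumes "x \<in> A"
  shows "root x \<in> cls x" "cls (root x) = cls x" "root x \<in> A" "root (root x) = root x"
proof -
  have "\<exists>m\<in>cls x. \<forall>y\<in>cls x. (m, y) \<in> r"
    using least[OF cls_carrier _ cls_chain] in_cls[OF assms] by blast
  then show *: "root x \<in> cls x" unfolding root_def by (rule someI2_bex) blast
  then show **: "cls (root x) = cls x" by (rule cls_eq)
  show "root x \<in> A" using * cls_carrier by blast
  show "root (root x) = root x" using ** by (simp add: root_def)
qed

lemma root_eq_iff: "x \<in> A \<Longrightarrow> y \<in> A \<Longrightarrow> root x = root y \<longleftrightarrow> y \<in> cls x"
proof
  assume xy: "x \<in> A" "y \<in> A" and eq: "root x = root y"
  have "cls x = cls y" using root(2)[OF xy(1)] root(2)[OF xy(2)] eq by simp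
  then show "y \<in> cls x" using in_cls[OF xy(2)] by simp
next
  assume "y \<in> cls x"
  then show "root x = root y" by (simp add: root_def cls_eq)
qed

definition reps :: "'a set" where
  "reps = root ` A"

lemma reps: "m \<in> reps \<longleftrightarrow> m \<in> A \<and> root m = m"
  unfolding reps_def using root by (auto intro: rev_image_eqI)

definition ord :: "'a \<Rightarrow> 'a rel" where
  "ord m = Restr r (cls m)"

lemma ord: "Well_order (ord m)" "Field (ord m) = cls m"
proof -
  have "well_ordered_chain_on (cls m) r"
    unfolding well_ordered_chain_on_def
  proof (intro conjI allI impI cls_chain)
    fix Y assume Y: "Y \<subseteq> cls m" "Y \<noteq> {}"
    show "\<exists>m\<in>Y. \<forall>y\<in>Y. (m, y) \<in> r"
      using least[OF order_trans[OF Y(1) cls_carrier] Y(2) chain_on_subset[OF cls_chain Y(1)]] .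
  qed
  then have "well_order_on (cls m) (ord m)"
    unfolding ord_def by (rule well_order_on_Restr_if_well_ordered_chain[OF po cls_carrier])
  then show "Well_order (ord m)" "Field (ord m) = cls m" using well_order_on_Well_order by blast+
qed

text \<open>Apply \<open>common_chain\<close> to \<open>X\<close> and itself: unbounded finite
  chains would force an infinite chain to embed in \<open>X\<close>, and its image would lie in a
  single class.\<close>

lemma not_unbounded_chains:
  assumes X: "X \<subseteq> A" and fin: "\<And>x. x \<in> X \<Longrightarrow> finite (X \<inter> cls x)"
  shows "\<not> unbounded_chains X r"
proof
  assume "unbounded_chains X r"
  then obtain G where G: "infinite G" "chain_on G r" "order_embeds G r X r"
    using common_chain[OF X _ X] by blast
  obtain f where f: "inj_on f G" "\<And>x. x \<in> G \<Longrightarrow> f x \<in> X"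
    "\<And>x y. x \<in> G \<Longrightarrow> y \<in> G \<Longrightarrow> (x, y) \<in> r \<longleftrightarrow> (f x, f y) \<in> r"
    using G(3) by (rule order_embedsE) blast
  obtain a where a: "a \<in> G" using G(1) by (metis finite.emptyI ex_in_conv)
  have "f ` G \<subseteq> X \<inter> cls (f a)"
    using f(2,3) G(2) a by (fastforce simp: chain_on_def cls_def)
  then have "finite (f ` G)" using fin[OF f(2)[OF a]] by (rule finite_subset)
  then show False using finite_imageD[OF _ f(1)] G(1) by blast
qed

text \<open>From infinitely many infinite classes, take \<open>i\<close> points of the
  \<open>i\<close>-th one. The resulting set meets every class finitely but has chains of all finite
  sizes.\<close>

lemma finite_infinite_classes: "finite {m \<in> reps. infinite (cls m)}"
proof (rule ccontr)
  assume "\<not> ?thesis"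
  then obtain s :: "nat \<Rightarrow> 'a" where s: "inj s" "range s \<subseteq> {m \<in> reps. infinite (cls m)}"
    using infinite_countable_subset by blast
  have sr: "s i \<in> A" "root (s i) = s i" "infinite (cls (s i))" for i
  proof -
    have "s i \<in> {m \<in> reps. infinite (cls m)}" using s(2) by blast
    then show "s i \<in> A" "root (s i) = s i" "infinite (cls (s i))" by (simp_all add: reps)
  qed
  have "\<exists>d. d \<subseteq> cls (s i) \<and> finite d \<and> card d = i" for i
    using infinite_arbitrarily_large[OF sr(3)] by blast
  then obtain d where d: "\<And>i. d i \<subseteq> cls (s i) \<and> finite (d i) \<and> card (d i) = i" by metis
  let ?X = "\<Union>i. d i"
  have XA: "?X \<subseteq> A" using d cls_carrier by blast
  have "finite (?X \<inter> cls x)" if x: "x \<in> ?X" for x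
  proof -
    obtain i where i: "x \<in> d i" using x by blast
    have "cls x = cls (s i)" using cls_eq d i by blast
    moreover have "y \<in> d i" if y: "y \<in> d j" "y \<in> cls (s i)" for y j
    proof -
      have "cls y = cls (s i)" "cls y = cls (s j)" using cls_eq d y by blast+
      then have "root (s i) = root (s j)" using in_cls[OF sr(1)] by (simp add: root_def)
      then have "i = j" using sr(2) inj_onD[OF s(1)] by simp
      then show ?thesis using y(1) by simp
    qed
    ultimately have "?X \<inter> cls x \<subseteq> d i" by blast
    then show ?thesis using d finite_subset by blast
  qed
  then have "\<not> unbounded_chains ?X r" by (rule not_unbounded_chains[OF XA])
  moreover have "chain_on (d i) r" for i
    using d by (intro chain_on_subset[OF cls_chain]) blast
  then have "unbounded_chains ?X r"
    unfolding unbounded_chains_def using d by (metis UN_upper UNIV_I)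
  ultimately show False by blast
qed

text \<open>The union of all finite classes omits some chain size \<open>n\<close>; a finite class
  with at least \<open>n\<close> points would contain such a chain.\<close>

lemma bounded_finite_classes: "\<exists>n. \<forall>m\<in>A. finite (cls m) \<longrightarrow> card (cls m) < n"
proof -
  let ?X = "{x \<in> A. finite (cls x)}"
  have "\<not> unbounded_chains ?X r" by (rule not_unbounded_chains) auto
  then obtain n where n: "\<And>c. c \<subseteq> ?X \<Longrightarrow> finite c \<Longrightarrow> chain_on c r \<Longrightarrow> card c \<noteq> n"
    unfolding unbounded_chains_def by blast
  have "card (cls m) < n" if m: "m \<in> A" "finite (cls m)" for m
  proof (rule ccontr)
    assume "\<not> card (cls m) < n"
    then obtain c where c: "c \<subseteq> cls m" "card c = n" "finite c"
      using obtain_subset_with_card_n[of n "cls m"] by (metis not_less)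
    have "c \<subseteq> ?X"
    proof
      fix x assume x: "x \<in> c"
      then have "cls x = cls m" using c(1) cls_eq by blast
      then show "x \<in> ?X" using x c(1) cls_carrier m(2) by auto
    qed
    then show False using n[OF _ c(3) chain_on_subset[OF cls_chain c(1)]] c(2) by blast
  qed
  then show ?thesis by blast
qed

text \<open>One root for each order type of classes, so that distinct board entries have
  non-isomorphic orders.\<close>

definition kind :: "'a \<Rightarrow> 'a" where
  "kind m = (SOME m'. m' \<in> reps \<and> ord m' =o ord m)"

lemma kind:
  assumes "m \<in> reps"
  shows "kind m \<in> reps" "ord (kind m) =o ord m"
proof -
  have "\<exists>m'. m' \<in> reps \<and> ord m' =o ord m"
    using assms ordIso_reflexive[OF ord(1)] by blast
  then have "kind m \<in> reps \<and> ord (kind m) =o ord m" unfolding kind_def by (rule someI_ex)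
  then show "kind m \<in> reps" "ord (kind m) =o ord m" by simp_all
qed

lemma kind_cong:
  assumes "ord m =o ord m'"
  shows "kind m = kind m'"
proof -
  have "ord n =o ord m \<longleftrightarrow> ord n =o ord m'" for n
    using assms ordIso_transitive ordIso_symmetric by blast
  then show ?thesis by (simp add: kind_def)
qed

text \<open>Finite classes are determined up to isomorphism by their size, which is bounded, and
  there are finitely many infinite classes.\<close>

lemma finite_kind: "finite (kind ` reps)"
proof -
  obtain n where n: "\<And>m. m \<in> A \<Longrightarrow> finite (cls m) \<Longrightarrow> card (cls m) < n"
    using bounded_finite_classes by blast
  define F where "F = {m \<in> reps. finite (cls m)}"
  have "kind ` F \<subseteq> (\<lambda>k. kind (SOME m. m \<in> F \<and> card (cls m) = k)) ` {..<n}"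
  proof
    fix t assume "t \<in> kind ` F"
    then obtain m where m: "m \<in> F" "t = kind m" by blast
    let ?m = "SOME m'. m' \<in> F \<and> card (cls m') = card (cls m)"
    have "?m \<in> F \<and> card (cls ?m) = card (cls m)"
      by (rule someI[of _ m]) (use m in simp)
    then have "ord m =o ord ?m"
      using m by (intro finite_well_orders_ordIso ord(1)) (simp_all add: ord(2) F_def)
    then have "t = kind ?m" using kind_cong m(2) by blast
    moreover have "card (cls m) < n" using m(1) n by (simp add: F_def reps)
    ultimately show "t \<in> (\<lambda>k. kind (SOME m. m \<in> F \<and> card (cls m) = k)) ` {..<n}" by blast
  qed
  then have "finite (kind ` F)" by (rule finite_subset) simp
  moreover have "kind ` reps \<subseteq> kind ` F \<union> kind ` {m \<in> reps. infinite (cls m)}" by (auto simp: F_def)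
  ultimately show ?thesis using finite_infinite_classes by (meson finite_UnI finite_imageI finite_subset)
qed

text \<open>The least elements of the classes of type \<open>t\<close> serve as the indices of the copies of \<open>t\<close>.\<close>

definition entry :: "'a \<Rightarrow> 'a rel \<times> 'a rel" where
  "entry t = (ord t, |{m \<in> reps. kind m = t}| )"

lemma kind_eq_if_ordIso:
  assumes "t \<in> kind ` reps" "t' \<in> kind ` reps" "ord t =o ord t'"
  shows "t = t'"
proof -
  have kind_id: "kind t = t" if "t \<in> kind ` reps" for t
    using that kind_cong[OF kind(2)] by auto
  have "t = kind t" using kind_id[OF assms(1)] by (rule sym)
  also have "\<dots> = kind t'" by (rule kind_cong[OF assms(3)])
  also have "\<dots> = t'" by (rule kind_id[OF assms(2)])
  finally show ?thesis .
qed

text \<open>If an order type is infinite, all its copies are among the finitely many infinite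
  classes, so its multiplicity is finite.\<close>

lemma pinboard_entries: "pinboard (entry ` kind ` reps)"
proof -
  let ?B = "entry ` kind ` reps"
  have 1: "Well_order h \<and> Card_order f \<and> \<not> (infinite (Field h) \<and> infinite (Field f))"
    if hf: "(h, f) \<in> ?B" for h f
  proof -
    obtain m where e: "(h, f) = entry (kind m)" and m: "m \<in> reps" using hf by auto
    let ?Q = "{m' \<in> reps. kind m' = kind m}"
    have h: "h = ord (kind m)" and f: "f = |?Q|" using e by (simp_all add: entry_def)
    have "finite ?Q" if "infinite (cls (kind m))"
    proof (rule finite_subset[OF _ finite_infinite_classes])
      show "?Q \<subseteq> {m \<in> reps. infinite (cls m)}"
      proof
        fix m' assume m': "m' \<in> ?Q"
        then have "ord (kind m) =o ord m'" using kind(2)[of m'] by simp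
        then have "|cls (kind m)| =o |cls m'|" using card_of_cong ord(2) by metis
        then show "m' \<in> {m \<in> reps. infinite (cls m)}" using that m' card_of_ordIso_finite by blast
      qed
    qed
    then show ?thesis
      using ord(1)[of "kind m"]
      by (auto simp: h f ord(2) card_of_card_order_on Field_card_of)
  qed
  have 2: "h = h' \<and> f = f'" if hf: "(h, f) \<in> ?B" "(h', f') \<in> ?B" and iso: "h =o h'" for h f h' f'
  proof -
    obtain m m' where e: "(h, f) = entry (kind m)" "(h', f') = entry (kind m')"
      and m: "m \<in> reps" "m' \<in> reps" using hf by auto
    have "kind m = kind m'"
      by (rule kind_eq_if_ordIso) (use e m iso in \<open>auto simp: entry_def\<close>)
    then show ?thesis using e by (metis prod.inject)
  qed
  show ?thesis
    unfolding pinboard_def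
  proof (intro conjI)
    show "finite ?B" using finite_kind by simp
    show "\<forall>(h, f)\<in>?B. Well_order h \<and> Card_order f \<and> \<not> (infinite (Field h) \<and> infinite (Field f))"
      using 1 by blast
    show "\<forall>(h, f)\<in>?B. \<forall>(h', f')\<in>?B. h =o h' \<and> f =o f' \<longrightarrow> h = h' \<and> f = f'"
      using 2 by blast
  qed
qed

lemma pinboard_poset: "pinboard_poset A r"
proof -
  let ?B = "entry ` kind ` reps"
  have "\<exists>f. bij_betw f (cls m) (cls (kind m)) \<and>
      (\<forall>x\<in>cls m. \<forall>y\<in>cls m. (x, y) \<in> ord m \<longleftrightarrow> (f x, f y) \<in> ord (kind m))" if "m \<in> reps" for m
  proof -
    have "ord m =o ord (kind m)" using kind(2)[OF that] by (rule ordIso_symmetric)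
    then show ?thesis by (rule ordIsoE) (auto simp: ord(2))
  qed
  then obtain \<iota> where \<iota>: "\<And>m. m \<in> reps \<Longrightarrow> bij_betw (\<iota> m) (cls m) (cls (kind m)) \<and>
      (\<forall>x\<in>cls m. \<forall>y\<in>cls m. (x, y) \<in> ord m \<longleftrightarrow> (\<iota> m x, \<iota> m y) \<in> ord (kind m))"
    by metis
  have root_reps: "root x \<in> reps" "x \<in> cls (root x)" if "x \<in> A" for x
    using that root in_cls by (simp_all add: reps)
  \<comment> \<open>A point is located by the type of its class, by the root as the copy number, and
    by its position carried over to the representative class of that type.\<close>
  define \<Phi> where "\<Phi> x = (entry (kind (root x)), root x, \<iota> (root x) x)" for x
  have Field_entry: "Field (fst (entry t)) = cls t" "Field (snd (entry t)) = {m \<in> reps. kind m = t}" for t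
    by (simp_all add: entry_def ord(2) Field_card_of)
  have carrier: "(b, c, x) \<in> board_carrier ?B \<longleftrightarrow> c \<in> reps \<and> b = entry (kind c) \<and> x \<in> cls (kind c)"
    for b c x
  proof -
    have "(b, c, x) \<in> board_carrier ?B \<longleftrightarrow> b \<in> ?B \<and> c \<in> Field (snd b) \<and> x \<in> Field (fst b)"
      by (cases b) (auto simp: board_carrier_def)
    also have "\<dots> \<longleftrightarrow> c \<in> reps \<and> b = entry (kind c) \<and> x \<in> cls (kind c)"
      by (auto simp: Field_entry)
    finally show ?thesis .
  qed
  have "bij_betw \<Phi> A (board_carrier ?B)"
    unfolding bij_betw_def
  proof
    show "inj_on \<Phi> A"
    proof (rule inj_onI)
      fix x y assume xy: "x \<in> A" "y \<in> A" "\<Phi> x = \<Phi> y"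
      then have b: "root x = root y" "\<iota> (root x) x = \<iota> (root x) y" by (auto simp: \<Phi>_def)
      have "inj_on (\<iota> (root x)) (cls (root x))"
        using \<iota> root_reps(1)[OF xy(1)] by (simp add: bij_betw_def)
      then show "x = y" using b root_reps(2)[OF xy(1)] root_reps(2)[OF xy(2)] by (simp add: inj_on_def)
    qed
    show "\<Phi> ` A = board_carrier ?B"
    proof
      show "\<Phi> ` A \<subseteq> board_carrier ?B"
        using \<iota> root_reps bij_betwE by (fastforce simp: \<Phi>_def carrier)
      show "board_carrier ?B \<subseteq> \<Phi> ` A"
      proof
        fix p assume "p \<in> board_carrier ?B"
        then obtain b c x where p: "p = (b, c, x)" "c \<in> reps" "b = entry (kind c)" "x \<in> cls (kind c)"
          using carrier by (cases p) auto
        then have "x \<in> \<iota> c ` cls c" using \<iota>[OF p(2)] by (simp add: bij_betw_def)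
        then obtain y where y: "y \<in> cls c" "x = \<iota> c y" by blast
        have yA: "y \<in> A" using y(1) cls_carrier by blast
        have "root y = c" using cls_eq[OF y(1)] p(2) by (simp add: reps root_def)
        then have "p = \<Phi> y" using p y by (simp add: \<Phi>_def)
        then show "p \<in> \<Phi> ` A" using yA by blast
      qed
    qed
  qed
  moreover have "(x, y) \<in> r \<longleftrightarrow> (\<Phi> x, \<Phi> y) \<in> board_order ?B" if xy: "x \<in> A" "y \<in> A" for x y
  proof -
    have order: "((b, c, u), (b', c', v)) \<in> board_order ?B \<longleftrightarrow>
        b = b' \<and> c = c' \<and> b \<in> ?B \<and> c \<in> Field (snd b) \<and> (u, v) \<in> fst b" for b c u b' c' v
      by (cases b; cases b') (auto simp: board_order_def)
    have "(\<Phi> x, \<Phi> y) \<in> board_order ?B \<longleftrightarrow>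
        root x = root y \<and> (\<iota> (root x) x, \<iota> (root x) y) \<in> ord (kind (root x))"
      unfolding \<Phi>_def order Field_entry using root_reps(1)[OF xy(1)] by (auto simp: entry_def)
    also have "\<dots> \<longleftrightarrow> root x = root y \<and> (x, y) \<in> ord (root x)"
      using \<iota>[OF root_reps(1)[OF xy(1)]] root_reps(2)[OF xy(1)] root_reps(2)[OF xy(2)] by auto
    also have "\<dots> \<longleftrightarrow> (x, y) \<in> r"
      using root_reps(2)[OF xy(1)] root_reps(2)[OF xy(2)] root_eq_iff[OF xy]
      by (auto simp: ord_def cls_def)
    finally show ?thesis ..
  qed
  ultimately have "order_isomorphic A r (board_carrier ?B) (board_order ?B)"
    unfolding order_isomorphic_def by blast
  then show ?thesis using pinboard_entries unfolding pinboard_poset_def by blast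
qed

end

theorem mainTheorem1:
  fixes A :: "'a set" and r :: "'a rel"
  assumes "partial_order_on A r"
  shows "sub_representable A r \<longleftrightarrow>
    flower A r \<or> co_flower A r \<or> pinboard_poset A r \<or> co_pinboard_poset A r"
proof
  assume "sub_representable A r"
  then obtain g where g: "\<And>X. X \<subseteq> A \<Longrightarrow> g X \<subseteq> A"
    "\<And>X Y. X \<subseteq> A \<Longrightarrow> Y \<subseteq> A \<Longrightarrow> order_embeds X r Y r \<longleftrightarrow> g X \<subseteq> g Y"
    "\<And>X. X \<subseteq> A \<Longrightarrow> order_embeds X r (g X) r"
    "\<And>X. X \<subseteq> A \<Longrightarrow> order_embeds (g X) r X r"
    by (rule sub_representableE) blast
  interpret represented_poset A r g
    by unfold_locales (use assms g in simp_all)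
  interpret dual: represented_poset A "r\<inverse>" g
    by (rule represented_converse)
  consider (V) x y z where "(x, y) \<in> r" "(x, z) \<in> r" "(y, z) \<notin> r" "(z, y) \<notin> r"
    | (Lambda) x y z where "(y, x) \<in> r" "(z, x) \<in> r" "(y, z) \<notin> r" "(z, y) \<notin> r"
    | (chains) "\<And>x y z. (x, y) \<in> r \<Longrightarrow> (x, z) \<in> r \<Longrightarrow> (y, z) \<in> r \<or> (z, y) \<in> r"
      "\<And>x y z. (y, x) \<in> r \<Longrightarrow> (z, x) \<in> r \<Longrightarrow> (y, z) \<in> r \<or> (z, y) \<in> r"
    by blast
  then show "flower A r \<or> co_flower A r \<or> pinboard_poset A r \<or> co_pinboard_poset A r"
  proof cases
    case (V x y z)
    then show ?thesis using flower_if_V by blast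
  next
    case (Lambda x y z)
    then have "flower A (r\<inverse>)" using dual.flower_if_V[of x y z] by simp
    then show ?thesis by (simp add: flower_converse)
  next
    case chains
    \<comment> \<open>Least elements of chains lead to a pinboard for \<open>r\<close>, greatest
      elements to one for the dual order, that is, to a co-pinboard.\<close>
    from greatest_or_least show ?thesis
    proof
      assume *: "\<forall>Y\<subseteq>A. Y \<noteq> {} \<and> chain_on Y r \<longrightarrow> (\<exists>m\<in>Y. \<forall>y\<in>Y. (m, y) \<in> r)"
      interpret chain_sum A r g
        by unfold_locales (use chains * in blast)+
      show ?thesis using pinboard_poset by blast
    next
      assume *: "\<forall>Y\<subseteq>A. Y \<noteq> {} \<and> chain_on Y r \<longrightarrow> (\<exists>m\<in>Y. \<forall>y\<in>Y. (y, m) \<in> r)"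
      interpret chain_sum A "r\<inverse>" g
      proof unfold_locales
        show "(y, z) \<in> r\<inverse> \<or> (z, y) \<in> r\<inverse>" if "(x, y) \<in> r\<inverse>" "(x, z) \<in> r\<inverse>" for x y z
          using chains(2)[of y x z] that by auto
        show "(y, z) \<in> r\<inverse> \<or> (z, y) \<in> r\<inverse>" if "(y, x) \<in> r\<inverse>" "(z, x) \<in> r\<inverse>" for x y z
          using chains(1)[of x y z] that by auto
        show "\<exists>m\<in>Y. \<forall>y\<in>Y. (m, y) \<in> r\<inverse>" if "Y \<subseteq> A" "Y \<noteq> {}" "chain_on Y (r\<inverse>)" for Y
          using * that by (simp add: chain_on_converse)
      qed
      show ?thesis using pinboard_poset by (simp add: pinboard_poset_converse)
    qed
  qed
next
  have co: "partial_order_on A (r\<inverse>)" using assms by (simp add: partial_order_on_converse)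
  assume "flower A r \<or> co_flower A r \<or> pinboard_poset A r \<or> co_pinboard_poset A r"
  \<comment> \<open>Flowers and co-pinboards are turned over, so that all four cases rest on
    well-orders.\<close>
  then consider "co_flower A (r\<inverse>)" | "co_flower A r" | "pinboard_poset A r" | "pinboard_poset A (r\<inverse>)"
    using flower_converse[of A "r\<inverse>"] pinboard_poset_converse[of A r] by auto
  then show "sub_representable A r"
  proof cases
    case 1
    then show ?thesis using sub_representable_if_co_flower[OF co] sub_representable_converse by blast
  next
    case 2
    then show ?thesis by (rule sub_representable_if_co_flower[OF assms])
  next
    case 3
    then show ?thesis by (rule sub_representable_if_pinboard_poset)
  next
    case 4
    then show ?thesis using sub_representable_if_pinboard_poset sub_representable_converse by blast
  qed
qed

end
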